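(* Let $\mathbb{P}$ be the set of all prime numbers. For all integers $b\ge2$ and $k\ge0$, $$\alpha_k(\mathbb{P},b)=\max\left\{0,\ \left\lfloor\frac{k-\omega(b)}{\varphi(b)}\right\rfloor+\left\lfloor\frac{k-\omega(b)}{b\varphi(b)}\right\rfloor+\left\lfloor\frac{k-\omega(b)}{b^2\varphi(b)}\right\rfloor+\cdots\right\},$$ where $\varphi$ is Euler's totient function and $\omega(b)$ is the number of distinct prime divisors of $b$. In particular, $\alpha_k(\mathbb{P},b)=0$ if $\varphi(b)+\omega(b)>k$.
   Context: For $b\ge2$ and $a\in\mathbb{Z}$, $\operatorname{ord}_b(a)$ is the largest $k\in\mathbb{N}$ with $b^k\mid a$ ($+\infty$ for $a=0$). For nonempty $S\subseteq\mathbb{Z}$, a $b$-ordering of $S$ is a sequence $(a_i)_{i\ge0}$ in $S$ such that for each $i\ge1$, $a_i$ attains $\min_{a'\in S}\sum_{j=0}^{i-1}\operatorname{ord}_b(a'-a_j)$; the $b$-exponent sequence of $S$ is $\alpha_k(S,b):=\sum_{j=0}^{k-1}\operatorname{ord}_b(a_k-a_j)$ for any $b$-ordering (independent of the choice). *)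

theory Defs
  imports "HOL-Number_Theory.Number_Theory" "HOL-Library.Extended_Nat"
begin

definition ord_b :: "nat \<Rightarrow> int \<Rightarrow> enat" where
  "ord_b b a = (if a = 0 then \<infinity> else enat (Max {k. int b ^ k dvd a}))"

definition ord_sum :: "nat \<Rightarrow> (nat \<Rightarrow> int) \<Rightarrow> nat \<Rightarrow> int \<Rightarrow> enat" where
  "ord_sum b a i x = (\<Sum>j<i. ord_b b (x - a j))"

definition is_b_ordering :: "nat \<Rightarrow> int set \<Rightarrow> (nat \<Rightarrow> int) \<Rightarrow> bool" where
  "is_b_ordering b S a \<longleftrightarrow>
     (\<forall>i. a i \<in> S) \<and>
     (\<forall>i\<ge>1. \<forall>x\<in>S. ord_sum b a i (a i) \<le> ord_sum b a i x)"

definition alpha_of :: "nat \<Rightarrow> (nat \<Rightarrow> int) \<Rightarrow> nat \<Rightarrow> enat" where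
  "alpha_of b a k = ord_sum b a k (a k)"

definition omega :: "nat \<Rightarrow> nat" where
  "omega b = card (prime_factors b)"

end

theory Submission
  imports Defs "HOL-Analysis.Analysis"
begin

text \<open>Only congruences modulo powers of \<open>b\<close> matter. A prime dividing \<open>b\<close> is congruent modulo \<open>b\<close> to no
  other prime, so it costs nothing until it is used and is infinitely expensive afterwards. The remaining
  primes fill, by Dirichlet's theorem, every unit class modulo every \<open>b ^ m\<close>, and a greedy choice spreads
  the first \<open>c\<close> of them evenly over these classes, at cost \<open>\<Sum>m\<ge>1. \<lfloor>c / \<phi>(b ^ m)\<rfloor>\<close>. Once this cost is positive,
  all \<open>\<omega>(b)\<close> primes dividing \<open>b\<close> have been used, so \<open>c = k - \<omega>(b)\<close>.

  Dirichlet's theorem is obtained from the series \<open>L(s) = \<Sum> \<psi>(n) n powr - s\<close> for real \<open>s \<ge> 1\<close>. With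
  \<open>F(s) = \<Sum> \<psi>(n) \<Lambda>(n) n powr - s\<close> one has \<open>L' = - L F\<close>, so \<open>F\<close> stays bounded near 1 when \<open>L(1) \<noteq> 0\<close>. For
  non-real \<open>\<psi>\<close> non-vanishing holds because the product of all \<open>\<bar>L\<bar>\<close> is nonincreasing in \<open>s\<close> (the sum of all
  \<open>F\<close> is nonnegative), whereas two zeros would outweigh the single pole; for real \<open>\<psi>\<close> it is Monsky's
  argument with the Lambert series \<open>\<Sum> \<psi>(n) t ^ n / (1 - t ^ n)\<close>.\<close>

section \<open>Dirichlet characters\<close>

text \<open>For composite \<open>b\<close>, \<open>ord_b\<close> is not additive on products, so
  everything rests on counting congruences one level \<open>b ^ m\<close> at a time. The levels
  cannot be optimised independently, because one prime fixes its class at all of them. They are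
  compatible because a unit class modulo \<open>b ^ m\<close>, m >= 1, splits into exactly
  \<open>b\<close> unit classes modulo \<open>b ^ (m + 1)\<close>. This bounds the minimum from
  above. Equality has to be shown for every ordering, not for one built on purpose, so the balance
  of all levels must be extracted from minimality alone.

  On the analytic side \<open>s\<close> stays real and at least 1: the mean value inequality at 1
  replaces orders of zeros, and derivatives of squared norms replace logarithms of L-values, so
  possible zeros do no harm. Characters live on \<open>nat\<close>; that they separate unit classes
  comes from extending homomorphisms one element at a time, without a structure theorem for the unit
  group.\<close>

definition dcharacters :: "nat \<Rightarrow> (nat \<Rightarrow> complex) set" where
  "dcharacters q = {\<psi>. \<psi> 1 = 1 \<and> (\<forall>m n. \<psi> (m * n) = \<psi> m * \<psi> n) \<and>
     (\<forall>m n. [m = n] (mod q) \<longrightarrow> \<psi> m = \<psi> n) \<and> (\<forall>n. \<not> coprime n q \<longrightarrow> \<psi> n = 0)}"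

text \<open>A homomorphism on a subgroup of the units modulo \<open>q\<close>, with the subgroup
  encoded as the union of its residue classes in \<open>nat\<close>. Closure under inverses follows
  from finiteness.\<close>

definition partial_character :: "nat \<Rightarrow> nat set \<Rightarrow> (nat \<Rightarrow> complex) \<Rightarrow> bool" where
  "partial_character q H f \<longleftrightarrow> 1 \<in> H \<and> f 1 = 1 \<and> (\<forall>n\<in>H. coprime n q) \<and>
     (\<forall>m\<in>H. \<forall>n\<in>H. m * n \<in> H \<and> f (m * n) = f m * f n) \<and>
     (\<forall>m\<in>H. \<forall>n. [m = n] (mod q) \<longrightarrow> n \<in> H \<and> f m = f n)"

lemma partial_characterD:
  assumes "partial_character q H f"
  shows "1 \<in> H" "f 1 = 1" "n \<in> H \<Longrightarrow> coprime n q"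
    "m \<in> H \<Longrightarrow> n \<in> H \<Longrightarrow> m * n \<in> H" "m \<in> H \<Longrightarrow> n \<in> H \<Longrightarrow> f (m * n) = f m * f n"
    "m \<in> H \<Longrightarrow> [m = n] (mod q) \<Longrightarrow> n \<in> H" "m \<in> H \<Longrightarrow> [m = n] (mod q) \<Longrightarrow> f m = f n"
  using assms unfolding partial_character_def by blast+

lemma partial_character_power:
  assumes "partial_character q H f" "u \<in> H"
  shows "u ^ t \<in> H \<and> f (u ^ t) = f u ^ t"
  using partial_characterD(1,2,4,5)[OF assms(1)] assms(2) by (induction t) simp_all

text \<open>By Euler's theorem \<open>u ^ (totient q - 1)\<close> is an inverse of \<open>u\<close>
  modulo \<open>q\<close>, and it lies in \<open>H\<close>.\<close>

lemma partial_character_cancel: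
  assumes H: "partial_character q H f" and "u \<in> H" "u * v \<in> H" and "q > 0"
  shows "v \<in> H"
proof -
  note D = partial_characterD[OF H]
  have "totient q > 0" using \<open>q > 0\<close> by simp
  then have "u ^ (totient q - 1) * (u * v) = u ^ totient q * v"
    by (simp add: power_eq_if algebra_simps)
  moreover have "[u ^ totient q * v = 1 * v] (mod q)"
    using euler_theorem[OF D(3)[OF \<open>u \<in> H\<close>]] by (intro cong_mult) auto
  ultimately have "[u ^ (totient q - 1) * (u * v) = v] (mod q)" by (simp only: mult_1)
  moreover have "u ^ (totient q - 1) * (u * v) \<in> H"
    using D(4) partial_character_power[OF H \<open>u \<in> H\<close>] assms by blast
  ultimately show ?thesis using D(6) by blast
qed

text \<open>If c = 1 there are m >= 2 roots to choose from; otherwise 1 is not a root at all. This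
  freedom makes the extended character nontrivial at the new element.\<close>

lemma exists_complex_root_neq_1:
  assumes "m \<ge> 2"
  shows "\<exists>w::complex. w ^ m = c \<and> w \<noteq> 1"
proof (cases "c = 1")
  case True
  have "card {z::complex. z ^ m = 1} = m"
    using assms by (intro card_roots_unity_eq) auto
  then have "\<not> {z::complex. z ^ m = 1} \<subseteq> {1}"
    using assms card_mono[of "{1::complex}" "{z. z ^ m = 1}"] by auto
  then show ?thesis using True by blast
next
  case False
  obtain w where "c = w ^ m" using exists_complex_root[of m c] assms by auto
  then show ?thesis using False by (intro exI[of _ w]) auto
qed

text \<open>\<open>w\<close> is the value that the extension will take at \<open>x\<close>. The
  least \<open>m\<close> > 0 with \<open>x ^ m\<close> in \<open>H\<close> is the order of
  \<open>x\<close> in the quotient by \<open>H\<close>, so the only constraint on \<open>w\<close>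
  is its \<open>m\<close>-th power; \<open>m\<close> >= 2 since \<open>x\<close> is outside
  \<open>H\<close>.\<close>

lemma partial_character_extend_aux:
  assumes H: "partial_character q H f" and x: "x \<notin> H" "coprime x q" and "q > 0"
  shows "\<exists>w. w \<noteq> 1 \<and> (\<forall>k. x ^ k \<in> H \<longrightarrow> f (x ^ k) = w ^ k)"
proof -
  note D = partial_characterD[OF H]
  define m where "m = (LEAST m. m > 0 \<and> x ^ m \<in> H)"
  have "x ^ totient q \<in> H"
    using euler_theorem[OF x(2)] D(6)[OF D(1)] cong_sym by blast
  then have "m > 0 \<and> x ^ m \<in> H"
    unfolding m_def using \<open>q > 0\<close> LeastI[of "\<lambda>m. m > 0 \<and> x ^ m \<in> H" "totient q"] by simp
  moreover from this have "m \<noteq> 1" using x(1) by auto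
  ultimately have m: "m \<ge> 2" "x ^ m \<in> H" by auto
  obtain w where w: "w ^ m = f (x ^ m)" "w \<noteq> 1" using exists_complex_root_neq_1[OF m(1)] by blast
  have "f (x ^ k) = w ^ k" if "x ^ k \<in> H" for k
  proof -
    have e: "x ^ k = (x ^ m) ^ (k div m) * x ^ (k mod m)"
      by (simp flip: power_mult power_add)
    have P: "(x ^ m) ^ (k div m) \<in> H \<and> f ((x ^ m) ^ (k div m)) = f (x ^ m) ^ (k div m)"
      using partial_character_power[OF H m(2)] by blast
    then have "x ^ (k mod m) \<in> H"
      using partial_character_cancel[OF H, of "(x ^ m) ^ (k div m)"] that e \<open>q > 0\<close> by metis
    moreover have "k mod m < m" using m(1) by simp
    ultimately have "k mod m = 0"
      using not_less_Least[of "k mod m" "\<lambda>m. m > 0 \<and> x ^ m \<in> H"] unfolding m_def[symmetric] by simp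
    then have "f (x ^ k) = (w ^ m) ^ (k div m)" "m * (k div m) = k"
      using P e w(1) by auto
    then show ?thesis by (simp flip: power_mult)
  qed
  then show ?thesis using w(2) by blast
qed

lemma partial_character_extend:
  assumes H: "partial_character q H f" and x: "x \<notin> H" "coprime x q" and "q > 0"
  shows "\<exists>H' f'. partial_character q H' f' \<and> H \<subseteq> H' \<and> x \<in> H' \<and> f' x \<noteq> 1 \<and> (\<forall>n\<in>H. f' n = f n)"
proof -
  note D = partial_characterD[OF H]
  obtain w where w: "w \<noteq> 1" "\<And>k. x ^ k \<in> H \<Longrightarrow> f (x ^ k) = w ^ k"
    using partial_character_extend_aux[OF assms] by blast
  \<comment> \<open>Two representations of one residue: cancelling the unit \<open>x ^ i\<close>
    leaves \<open>x ^ d\<close> in \<open>H\<close>, where \<open>f\<close> and the powers of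
    \<open>w\<close> agree.\<close>
  have wd_le: "f h = f h' * w ^ d" if "h \<in> H" "h' \<in> H" "[h * x ^ i = h' * x ^ (i + d)] (mod q)" for h h' i d
  proof -
    have "coprime (x ^ i) q" using x(2) by simp
    then have "[h = h' * x ^ d] (mod q)"
      using that(3) cong_mult_rcancel_nat[of "x ^ i" q h "h' * x ^ d"]
      by (simp add: power_add mult_ac)
    then have 1: "h' * x ^ d \<in> H" "f h = f (h' * x ^ d)" using D(6,7)[OF that(1)] by auto
    then have "x ^ d \<in> H" using partial_character_cancel[OF H that(2)] \<open>q > 0\<close> by blast
    then show ?thesis using 1(2) D(5)[OF that(2)] w(2) by simp
  qed
  have wd: "f h * w ^ i = f h' * w ^ j" if "h \<in> H" "h' \<in> H" "[h * x ^ i = h' * x ^ j] (mod q)" for h h' i j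
  proof (cases "i \<le> j")
    case True
    then obtain d where "j = i + d" using le_Suc_ex by blast
    then show ?thesis using wd_le[of h h' i d] that by (simp add: power_add mult_ac)
  next
    case False
    then obtain d where "i = j + d" using le_Suc_ex by (metis nat_le_linear)
    then show ?thesis using wd_le[of h' h j d] that by (simp add: power_add mult_ac cong_sym)
  qed
  \<comment> \<open>The subgroup generated by \<open>H\<close> and \<open>x\<close>. Natural
    exponents suffice because \<open>x\<close> has finite order modulo \<open>q\<close>.\<close>
  define H' where "H' = {n. \<exists>h\<in>H. \<exists>i. [n = h * x ^ i] (mod q)}"
  define f' where "f' n = (THE z. \<exists>h\<in>H. \<exists>i. [n = h * x ^ i] (mod q) \<and> z = f h * w ^ i)" for n
  have f': "f' n = f h * w ^ i" if "h \<in> H" "[n = h * x ^ i] (mod q)" for n h i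
    unfolding f'_def
  proof (rule the_equality)
    show "\<exists>ha\<in>H. \<exists>ia. [n = ha * x ^ ia] (mod q) \<and> f h * w ^ i = f ha * w ^ ia" using that by blast
  next
    fix z assume "\<exists>h\<in>H. \<exists>i. [n = h * x ^ i] (mod q) \<and> z = f h * w ^ i"
    then obtain h' j where "h' \<in> H" "[n = h' * x ^ j] (mod q)" "z = f h' * w ^ j" by blast
    then show "z = f h * w ^ i" using wd[of h' h j i] that by (meson cong_sym cong_trans)
  qed
  have fH: "n \<in> H' \<and> f' n = f n" if "n \<in> H" for n
    using f'[OF that, of n 0] that unfolding H'_def by (auto intro!: bexI[of _ n] exI[of _ 0])
  have fx: "x \<in> H' \<and> f' x = w"
    using f'[OF D(1), of x 1] D(1,2) unfolding H'_def by (auto intro!: bexI[of _ 1] exI[of _ 1])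
  have "partial_character q H' f'"
    unfolding partial_character_def
  proof (intro conjI ballI allI impI)
    show "1 \<in> H'" "f' 1 = 1" using fH D(1,2) by auto
    fix n assume n: "n \<in> H'"
    then obtain h i where h: "h \<in> H" "[n = h * x ^ i] (mod q)" unfolding H'_def by blast
    then have "coprime (h * x ^ i) q" using D(3) x(2) by simp
    then show "coprime n q" using h(2) cong_imp_coprime cong_sym by blast
    fix n' 
    { assume "n' \<in> H'"
      then obtain h' i' where h': "h' \<in> H" "[n' = h' * x ^ i'] (mod q)" unfolding H'_def by blast
      have c: "[n * n' = (h * h') * x ^ (i + i')] (mod q)"
        using cong_mult[OF h(2) h'(2)] by (simp add: power_add mult_ac)
      then show "n * n' \<in> H'" using D(4)[OF h(1) h'(1)] unfolding H'_def by blast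
      show "f' (n * n') = f' n * f' n'"
        using f'[OF D(4)[OF h(1) h'(1)] c] f'[OF h] f'[OF h'] D(5)[OF h(1) h'(1)]
        by (simp add: power_add mult_ac) }
    assume "[n = n'] (mod q)"
    then have c: "[n' = h * x ^ i] (mod q)" using h(2) cong_sym cong_trans by blast
    then show "n' \<in> H'" using h(1) unfolding H'_def by blast
    show "f' n = f' n'" using f'[OF h] f'[OF h(1) c] by simp
  qed
  then show ?thesis using fH fx w(1) by blast
qed

text \<open>Induction on the number of residues below \<open>q\<close> outside \<open>H\<close>,
  which drops with each adjoined unit. Once \<open>H\<close> contains all units, \<open>f\<close> is
  continued by 0.\<close>

lemma partial_character_extend_full:
  assumes "partial_character q H f" "q > 0"
  shows "\<exists>\<psi>\<in>dcharacters q. \<forall>n\<in>H. \<psi> n = f n"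
  using assms(1)
proof (induction "card ({..<q} - H)" arbitrary: H f rule: less_induct)
  case less
  note D = partial_characterD[OF less.prems]
  show ?case
  proof (cases "\<exists>x. x \<notin> H \<and> coprime x q")
    case True
    then obtain x where x: "x \<notin> H" "coprime x q" by blast
    obtain H' f' where H': "partial_character q H' f'" "H \<subseteq> H'" "x \<in> H'" "\<forall>n\<in>H. f' n = f n"
      using partial_character_extend[OF less.prems x \<open>q > 0\<close>] by blast
    have "x mod q \<in> H'" using partial_characterD(6)[OF H'(1,3)] by simp
    moreover have "x mod q \<notin> H" using D(6) x(1) by (meson cong_mod_left cong_refl)
    ultimately have "{..<q} - H' \<subset> {..<q} - H" using H'(2) \<open>q > 0\<close>
      by (intro psubsetI) (auto dest!: equalityD2 simp: subset_iff)
    then have "card ({..<q} - H') < card ({..<q} - H)" by (intro psubset_card_mono) auto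
    from less.hyps[OF this H'(1)] obtain \<psi> where "\<psi> \<in> dcharacters q" "\<forall>n\<in>H'. \<psi> n = f' n" by blast
    moreover from this have "\<forall>n\<in>H. \<psi> n = f n" using H'(2,4) by auto
    ultimately show ?thesis by blast
  next
    case False
    then have iff: "n \<in> H \<longleftrightarrow> coprime n q" for n using D(3) by blast
    define \<psi> where "\<psi> n = (if n \<in> H then f n else 0)" for n
    have "\<psi> (m * n) = \<psi> m * \<psi> n" for m n
      using D(5)[of m n] by (auto simp: \<psi>_def iff)
    moreover have "\<psi> m = \<psi> n" if "[m = n] (mod q)" for m n
      using D(6,7)[of m n] D(6)[of n m] cong_sym[OF that] that unfolding \<psi>_def by auto
    ultimately have "\<psi> \<in> dcharacters q"
      using D(1,2) unfolding dcharacters_def by (auto simp: \<psi>_def iff)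
    then show ?thesis by (rule bexI[rotated]) (simp add: \<psi>_def)
  qed
qed

text \<open>Start from the trivial subgroup, the class of 1; the first extension, by
  \<open>x\<close> itself, already takes a value other than 1 there.\<close>

lemma dcharacters_separate:
  assumes "coprime x q" "\<not> [x = 1] (mod q)" "q > 0"
  shows "\<exists>\<psi>\<in>dcharacters q. \<psi> x \<noteq> 1"
proof -
  have "partial_character q {n. [n = 1] (mod q)} (\<lambda>_. 1)"
    unfolding partial_character_def using cong_mult[of _ 1 q _ 1] cong_imp_coprime[OF cong_sym, of _ 1 q]
    by (auto intro: cong_trans cong_sym)
  from partial_character_extend[OF this _ assms(1,3)] assms(2)
  obtain H f where "partial_character q H f" "x \<in> H" "f x \<noteq> 1" by auto
  then show ?thesis using partial_character_extend_full[OF _ \<open>q > 0\<close>] by metis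
qed

section \<open>Values, finiteness and orthogonality of characters\<close>

lemma dcharactersD:
  assumes "\<psi> \<in> dcharacters q"
  shows "\<psi> 1 = 1" "\<psi> (m * n) = \<psi> m * \<psi> n" "[m = n] (mod q) \<Longrightarrow> \<psi> m = \<psi> n"
    "\<not> coprime n q \<Longrightarrow> \<psi> n = 0"
  using assms unfolding dcharacters_def by blast+

lemma dcharacters_power:
  assumes "\<psi> \<in> dcharacters q"
  shows "\<psi> (n ^ k) = \<psi> n ^ k"
  using dcharactersD(1,2)[OF assms] by (induction k) auto

lemma dcharacters_root_of_unity:
  assumes "\<psi> \<in> dcharacters q" "coprime n q"
  shows "\<psi> n ^ totient q = 1"
  using dcharactersD(1,3)[OF assms(1)] dcharacters_power[OF assms(1)] euler_theorem[OF assms(2)] by metis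

lemma dcharacters_norm_coprime:
  assumes "\<psi> \<in> dcharacters q" "coprime n q" "q > 0"
  shows "norm (\<psi> n) = 1"
proof -
  have "norm (\<psi> n) ^ totient q = 1"
    using dcharacters_root_of_unity[OF assms(1,2)] by (metis norm_one norm_power)
  then show ?thesis using \<open>q > 0\<close> power_eq_imp_eq_base[of "norm (\<psi> n)" "totient q" 1] by simp
qed

lemma dcharacters_norm_le:
  assumes "\<psi> \<in> dcharacters q" "q > 0"
  shows "norm (\<psi> n) \<le> 1"
  using dcharacters_norm_coprime[OF assms(1) _ assms(2), of n] dcharactersD(4)[OF assms(1), of n]
  by (cases "coprime n q") auto

lemma dcharacters_mod:
  assumes "\<psi> \<in> dcharacters q"
  shows "\<psi> (n mod q) = \<psi> n"
  using dcharactersD(3)[OF assms] by simp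

lemma dcharacters_mult:
  assumes "\<psi> \<in> dcharacters q" "\<psi>' \<in> dcharacters q"
  shows "(\<lambda>n. \<psi> n * \<psi>' n) \<in> dcharacters q"
  using assms unfolding dcharacters_def by (auto simp: mult_ac)

lemma dcharacters_cnj:
  assumes "\<psi> \<in> dcharacters q"
  shows "(\<lambda>n. cnj (\<psi> n)) \<in> dcharacters q"
  using assms unfolding dcharacters_def by auto

definition principal_character :: "nat \<Rightarrow> nat \<Rightarrow> complex" where
  "principal_character q n = (if coprime n q then 1 else 0)"

lemma principal_character_in: "principal_character q \<in> dcharacters q"
  unfolding dcharacters_def principal_character_def
  using cong_imp_coprime cong_sym by auto blast+

lemma finite_dcharacters:
  assumes "q > 0"
  shows "finite (dcharacters q)"
proof (rule inj_on_finite)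
  let ?r = "\<lambda>\<psi>::nat \<Rightarrow> complex. restrict \<psi> {..<q}"
  show "inj_on ?r (dcharacters q)"
  proof (rule inj_onI, rule ext)
    fix \<psi> \<psi>' n assume *: "\<psi> \<in> dcharacters q" "\<psi>' \<in> dcharacters q" "?r \<psi> = ?r \<psi>'"
    have "\<psi> (n mod q) = \<psi>' (n mod q)"
      using fun_cong[OF *(3), of "n mod q"] assms by simp
    then show "\<psi> n = \<psi>' n" using dcharacters_mod *(1,2) by metis
  qed
  show "?r ` dcharacters q \<subseteq> {..<q} \<rightarrow>\<^sub>E insert 0 {z. z ^ totient q = 1}"
  proof (rule image_subsetI)
    fix \<psi> assume \<psi>: "\<psi> \<in> dcharacters q"
    have "\<psi> n = 0 \<or> \<psi> n ^ totient q = 1" for n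
      using dcharacters_root_of_unity[OF \<psi>, of n] dcharactersD(4)[OF \<psi>, of n] by blast
    with \<psi> show "?r \<psi> \<in> {..<q} \<rightarrow>\<^sub>E insert 0 {z. z ^ totient q = 1}" by (simp add: PiE_iff)
  qed
  show "finite ({..<q} \<rightarrow>\<^sub>E insert 0 {z::complex. z ^ totient q = 1})"
    using assms by (intro finite_PiE) (auto intro!: finite_roots_unity simp: Suc_le_eq)
qed

text \<open>For a unit \<open>n\<close> not congruent to 1, multiplication by a character with value
  other than 1 at \<open>n\<close> permutes all characters, so the sum equals a multiple of itself
  with factor other than 1.\<close>

lemma sum_dcharacters:
  assumes "q > 0"
  shows "(\<Sum>\<psi>\<in>dcharacters q. \<psi> n) = (if [n = 1] (mod q) then of_nat (card (dcharacters q)) else 0)"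
proof (cases "[n = 1] (mod q)")
  case True
  then have "\<psi> n = 1" if "\<psi> \<in> dcharacters q" for \<psi>
    using dcharactersD(1,3)[OF that] by metis
  then have "(\<Sum>\<psi>\<in>dcharacters q. \<psi> n) = (\<Sum>\<psi>\<in>dcharacters q. 1)" by (intro sum.cong) auto
  then show ?thesis using True by simp
next
  case False
  show ?thesis
  proof (cases "coprime n q")
    case True
    obtain \<psi>' where \<psi>': "\<psi>' \<in> dcharacters q" "\<psi>' n \<noteq> 1"
      using dcharacters_separate[OF True False assms] by blast
    let ?g = "\<lambda>\<psi> n. \<psi>' n * \<psi> n"
    have inj: "inj_on ?g (dcharacters q)"
    proof (rule inj_onI, rule ext)
      fix \<psi> \<theta> k assume *: "\<psi> \<in> dcharacters q" "\<theta> \<in> dcharacters q" "?g \<psi> = ?g \<theta>"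
      show "\<psi> k = \<theta> k"
      proof (cases "coprime k q")
        case True
        then have "\<psi>' k \<noteq> 0" using dcharacters_norm_coprime[OF \<psi>'(1) True assms] by auto
        then show ?thesis using fun_cong[OF *(3), of k] by simp
      qed (use dcharactersD(4)[OF *(1)] dcharactersD(4)[OF *(2)] in simp)
    qed
    have "?g ` dcharacters q = dcharacters q"
      using dcharacters_mult[OF \<psi>'(1)] by (intro endo_inj_surj[OF finite_dcharacters[OF assms] _ inj]) auto
    then have "(\<Sum>\<psi>\<in>dcharacters q. \<psi> n) = (\<Sum>\<psi>\<in>?g ` dcharacters q. \<psi> n)" by simp
    also have "\<dots> = (\<Sum>\<psi>\<in>dcharacters q. \<psi>' n * \<psi> n)"
      using sum.reindex[OF inj, of "\<lambda>\<psi>. \<psi> n"] by (simp add: o_def)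
    also have "\<dots> = \<psi>' n * (\<Sum>\<psi>\<in>dcharacters q. \<psi> n)"
      by (simp only: sum_distrib_left)
    finally have "(\<Sum>\<psi>\<in>dcharacters q. \<psi> n) = \<psi>' n * (\<Sum>\<psi>\<in>dcharacters q. \<psi> n)" .
    then show ?thesis using \<psi>'(2) False by (simp add: mult_cancel_right1)
  qed (use False dcharactersD(4) in \<open>simp add: sum.neutral\<close>)
qed

text \<open>The same device with residues permuted instead of characters: multiply by a unit
  \<open>m\<close> with \<psi>(m) other than 1.\<close>

lemma sum_dcharacter_period:
  assumes \<psi>: "\<psi> \<in> dcharacters q" "\<psi> \<noteq> principal_character q" and "q > 0"
  shows "(\<Sum>n<q. \<psi> n) = 0"
proof -
  obtain m where m: "\<psi> m \<noteq> principal_character q m" using \<psi>(2) by blast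
  then have cop: "coprime m q" using dcharactersD(4)[OF \<psi>(1)] by (auto simp: principal_character_def split: if_splits)
  let ?g = "\<lambda>n. m * n mod q"
  have inj: "inj_on ?g {..<q}"
  proof (rule inj_onI)
    fix x y assume *: "x \<in> {..<q}" "y \<in> {..<q}" "?g x = ?g y"
    then have "[m * x = m * y] (mod q)" by (simp add: unique_euclidean_semiring_class.cong_def)
    then have "[x = y] (mod q)" using cong_mult_lcancel_nat[OF cop] by blast
    then show "x = y" using * by (simp add: unique_euclidean_semiring_class.cong_def)
  qed
  have "?g ` {..<q} = {..<q}" using \<open>q > 0\<close> by (intro endo_inj_surj[OF _ _ inj]) auto
  then have "(\<Sum>n<q. \<psi> n) = (\<Sum>n\<in>?g ` {..<q}. \<psi> n)" by simp
  also have "\<dots> = (\<Sum>n<q. \<psi> m * \<psi> n)"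
    using sum.reindex[OF inj, of \<psi>] dcharacters_mod[OF \<psi>(1)] dcharactersD(2)[OF \<psi>(1)] by (simp add: o_def)
  also have "\<dots> = \<psi> m * (\<Sum>n<q. \<psi> n)" by (simp only: sum_distrib_left)
  finally have "(\<Sum>n<q. \<psi> n) = \<psi> m * (\<Sum>n<q. \<psi> n)" .
  then show ?thesis using m cop by (simp add: principal_character_def mult_cancel_right1)
qed

text \<open>Full periods cancel, so fewer than \<open>q\<close> terms of norm at most 1
  remain.\<close>

lemma norm_sum_dcharacter_le:
  assumes \<psi>: "\<psi> \<in> dcharacters q" "\<psi> \<noteq> principal_character q" and "q > 0"
  shows "norm (\<Sum>n<N. \<psi> n) \<le> q"
proof (induction N rule: less_induct)
  case (less N)
  show ?case
  proof (cases "N < q")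
    case True
    have "norm (\<Sum>n<N. \<psi> n) \<le> (\<Sum>n<N. 1)"
      by (rule sum_norm_le) (use dcharacters_norm_le[OF \<psi>(1) \<open>q > 0\<close>] in auto)
    then show ?thesis using True by simp
  next
    case False
    then obtain M where M: "N = q + M" using le_Suc_ex not_less by blast
    have "(\<Sum>n<N. \<psi> n) = (\<Sum>n<q. \<psi> n) + (\<Sum>n<M. \<psi> (n + q))"
      unfolding M lessThan_atLeast0 by (subst sum.atLeastLessThan_concat[symmetric, of 0 q])
        (use sum.shift_bounds_nat_ivl[of \<psi> 0 q M] in \<open>auto simp: add.commute\<close>)
    also have "\<dots> = (\<Sum>n<M. \<psi> n)"
      using sum_dcharacter_period[OF assms] dcharactersD(3)[OF \<psi>(1), of "n + q" n for n]
      by (simp add: unique_euclidean_semiring_class.cong_def cong: sum.cong)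
    finally show ?thesis using less.IH[of M] M \<open>q > 0\<close> by simp
  qed
qed

section \<open>The series of a character for real arguments\<close>

text \<open>Abel summation. The factor 2 arises because sums starting at \<open>M\<close> are
  differences of two partial sums starting at 0; the late start is needed for weights that decrease
  only eventually.\<close>

lemma norm_sum_mult_antimono_le:
  fixes a :: "nat \<Rightarrow> complex" and c :: "nat \<Rightarrow> real"
  assumes bound: "\<And>N. norm (\<Sum>n<N. a n) \<le> K"
    and dec: "\<And>n. n \<ge> M \<Longrightarrow> c (Suc n) \<le> c n" and nonneg: "\<And>n. n \<ge> M \<Longrightarrow> 0 \<le> c n"
  shows "norm (\<Sum>n=M..<N. a n * of_real (c n)) \<le> 2 * K * c M"
proof (cases "M \<le> N")
  case True
  define A where "A n = (\<Sum>i=M..<n. a i)" for n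
  have A: "norm (A n) \<le> 2 * K" if "n \<ge> M" for n
  proof -
    have "A n = (\<Sum>i<n. a i) - (\<Sum>i<M. a i)"
      unfolding A_def lessThan_atLeast0 using sum_diff_nat_ivl[of 0 M n a] that by simp
    then show ?thesis using norm_triangle_ineq4[of "\<Sum>i<n. a i" "\<Sum>i<M. a i"] bound[of n] bound[of M] by simp
  qed
  have "(\<Sum>n=M..<N. a n * of_real (c n)) =
      A N * of_real (c N) + (\<Sum>n=M..<N. A (Suc n) * of_real (c n - c (Suc n)))"
    using True
  proof (induction N rule: dec_induct)
    case (step n)
    then show ?case by (simp add: A_def algebra_simps)
  qed (simp add: A_def)
  also have "norm \<dots> \<le> norm (A N * of_real (c N)) + (\<Sum>n=M..<N. norm (A (Suc n) * of_real (c n - c (Suc n))))"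
    by (intro norm_triangle_le add_left_mono sum_norm_le) auto
  also have "norm (A N * of_real (c N)) \<le> 2 * K * c N"
    using A[OF True] nonneg[OF True] by (simp add: norm_mult mult_right_mono)
  also have "(\<Sum>n=M..<N. norm (A (Suc n) * of_real (c n - c (Suc n)))) \<le> (\<Sum>n=M..<N. 2 * K * (c n - c (Suc n)))"
  proof (rule sum_mono)
    fix n assume n: "n \<in> {M..<N}"
    have "norm (complex_of_real (c n - c (Suc n))) = c n - c (Suc n)"
      unfolding norm_of_real using dec[of n] n by simp
    then show "norm (A (Suc n) * of_real (c n - c (Suc n))) \<le> 2 * K * (c n - c (Suc n))"
      unfolding norm_mult using A[of "Suc n"] dec[of n] n by (simp add: mult_right_mono)
  qed
  also have "(\<Sum>n=M..<N. 2 * K * (c n - c (Suc n))) = 2 * K * (c M - c N)"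
    unfolding sum_distrib_left[symmetric] using sum_Suc_diff'[OF True, of "\<lambda>n. - c n"] by simp
  finally show ?thesis by (simp add: algebra_simps)
next
  case False
  have "0 \<le> K" using bound[of 0] by simp
  then show ?thesis using False nonneg[of M] by simp
qed

section \<open>The series for s > 1 and termwise differentiation\<close>

definition Lser :: "(nat \<Rightarrow> complex) \<Rightarrow> real \<Rightarrow> complex" where
  "Lser f s = (\<Sum>n. f n * of_real (real n powr - s))"

text \<open>Minus the termwise derivative of \<open>Lser\<close>. In all three series the term n = 0
  vanishes, because \<open>0 powr x = 0\<close>.\<close>

definition Dser :: "(nat \<Rightarrow> complex) \<Rightarrow> real \<Rightarrow> complex" where
  "Dser f s = (\<Sum>n. f n * of_real (ln (real n) * real n powr - s))"

definition Fser :: "(nat \<Rightarrow> complex) \<Rightarrow> real \<Rightarrow> complex" where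
  "Fser f s = (\<Sum>n. f n * of_real (mangoldt n * real n powr - s))"

lemma summable_powr_minus: "s > 1 \<Longrightarrow> summable (\<lambda>n. real n powr - s)"
  using summable_real_powr_iff[of "- s"] by simp

lemma summable_ln_powr:
  assumes "s > (1::real)"
  shows "summable (\<lambda>n. ln (real n) * real n powr - s)"
proof (rule summable_comparison_test)
  \<comment> \<open>Half of the room above 1 absorbs the logarithm through ln n <= n^a / a, and a -
    s is still below -1.\<close>
  define a where "a = (s - 1) / 2"
  have a: "a > 0" "a - s < -1" using assms by (auto simp: a_def field_simps)
  show "summable (\<lambda>n. real n powr (a - s) / a)"
    using a(2) summable_real_powr_iff by (intro summable_divide) simp
  show "\<exists>N. \<forall>n\<ge>N. norm (ln (real n) * real n powr - s) \<le> real n powr (a - s) / a"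
  proof (intro exI allI impI)
    fix n :: nat assume n: "n \<ge> 1"
    have "ln (real n) * real n powr - s \<le> real n powr a / a * real n powr - s"
      using ln_powr_bound[of "real n" a] n a(1) by (intro mult_right_mono) auto
    then show "norm (ln (real n) * real n powr - s) \<le> real n powr (a - s) / a"
      using n by (simp add: abs_mult powr_diff powr_minus field_simps)
  qed
qed

lemma mangoldt_powr_le: "mangoldt n * real n powr - s \<le> ln (real n) * real n powr - s"
  by (cases "n = 0") (auto intro!: mult_right_mono mangoldt_le)

lemma summable_mangoldt_powr:
  assumes "s > (1::real)"
  shows "summable (\<lambda>n. mangoldt n * real n powr - s)"
  by (rule summable_comparison_test'[OF summable_ln_powr[OF assms], of 0])
    (use mangoldt_powr_le in \<open>auto simp: mangoldt_nonneg abs_mult\<close>)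

lemma norm_coeff_le:
  fixes f :: "nat \<Rightarrow> complex"
  assumes "\<And>n. norm (f n) \<le> 1" "c \<ge> 0"
  shows "norm (f n * of_real c) \<le> c"
  using mult_right_mono[OF assms(1)[of n] assms(2)] assms(2) by (simp add: norm_mult)

lemma ln_nat_nonneg: "ln (real n) \<ge> 0"
  by (cases "n = 0") auto

lemma
  fixes f :: "nat \<Rightarrow> complex"
  assumes f: "\<And>n. norm (f n) \<le> 1" and s: "s > 1"
  shows summable_norm_Lser: "summable (\<lambda>n. norm (f n * of_real (real n powr - s)))"
    and summable_norm_Dser: "summable (\<lambda>n. norm (f n * of_real (ln (real n) * real n powr - s)))"
    and summable_norm_Fser: "summable (\<lambda>n. norm (f n * of_real (mangoldt n * real n powr - s)))"
proof -
  show "summable (\<lambda>n. norm (f n * of_real (real n powr - s)))"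
    by (rule summable_comparison_test'[OF summable_powr_minus[OF s], of 0])
      (use norm_coeff_le[where f = f, OF f] in auto)
  show "summable (\<lambda>n. norm (f n * of_real (ln (real n) * real n powr - s)))"
    by (rule summable_comparison_test'[OF summable_ln_powr[OF s], of 0])
      (use norm_coeff_le[where f = f, OF f] ln_nat_nonneg in \<open>simp del: of_real_mult\<close>)
  show "summable (\<lambda>n. norm (f n * of_real (mangoldt n * real n powr - s)))"
    by (rule summable_comparison_test'[OF summable_mangoldt_powr[OF s], of 0])
      (use norm_coeff_le[where f = f, OF f] mangoldt_nonneg in \<open>simp del: of_real_mult\<close>)
qed

lemma has_derivative_powr_term:
  "((\<lambda>s. f n * complex_of_real (real n powr - s)) has_derivative
     (\<lambda>h. h *\<^sub>R (- (f n * of_real (ln (real n) * real n powr - s))))) (at s within S)"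
proof (cases "n = 0")
  case False
  have "((\<lambda>s. real n powr - s) has_real_derivative - (ln (real n) * real n powr - s)) (at s within S)"
    using has_derivative_powr[OF has_derivative_const has_derivative_minus[OF has_derivative_ident], of "real n" s UNIV] False
    by - (rule has_field_derivative_at_within,
        auto simp: has_field_derivative_def algebra_simps elim!: has_derivative_eq_rhs)
  then have "((\<lambda>s. of_real (real n powr - s)) has_vector_derivative complex_of_real (- (ln (real n) * real n powr - s))) (at s within S)"
    by (intro has_vector_derivative_of_real) (auto simp: has_real_derivative_iff_has_vector_derivative)
  from has_vector_derivative_mult_right[OF this, of "f n"]
  show ?thesis by (simp add: has_vector_derivative_def)
qed simp

text \<open>Convergence at one point together with uniform convergence of the derived series is all
  that is assumed, so that the same lemma serves open half-lines to the right of 1 and the closed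
  half-line \<open>{1..}\<close>, where absolute convergence may fail.\<close>

lemma Lser_has_derivative:
  assumes "convex S" "x0 \<in> S" "summable (\<lambda>n. f n * of_real (real n powr - x0))"
    and unif: "uniform_limit S (\<lambda>N s. \<Sum>n<N. f n * of_real (ln (real n) * real n powr - s)) (Dser f) sequentially"
    and "s \<in> S"
  shows "(\<lambda>n. f n * of_real (real n powr - s)) sums Lser f s"
    and "(Lser f has_vector_derivative - Dser f s) (at s within S)"
proof -
  have "\<exists>g. \<forall>s\<in>S. (\<lambda>n. f n * of_real (real n powr - s)) sums g s \<and>
      (g has_derivative (\<lambda>h. h *\<^sub>R (- Dser f s))) (at s within S)"
  proof (rule has_derivative_series[OF \<open>convex S\<close> has_derivative_powr_term _ \<open>x0 \<in> S\<close>])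
    show "(\<lambda>n. f n * of_real (real n powr - x0)) sums suminf (\<lambda>n. f n * of_real (real n powr - x0))"
      using assms(3) by (simp add: summable_sums)
    fix e :: real assume "e > 0"
    from uniform_limitD[OF unif this]
    show "\<forall>\<^sub>F N in sequentially. \<forall>s\<in>S. \<forall>h. norm ((\<Sum>n<N. h *\<^sub>R (- (f n * of_real (ln (real n) * real n powr - s))))
        - h *\<^sub>R (- Dser f s)) \<le> e * norm h"
    proof eventually_elim
      case (elim N)
      show ?case
      proof (intro ballI allI)
        fix s h assume "s \<in> S"
        let ?P = "\<Sum>n<N. f n * of_real (ln (real n) * real n powr - s)"
        have "(\<Sum>n<N. h *\<^sub>R (- (f n * of_real (ln (real n) * real n powr - s)))) - h *\<^sub>R (- Dser f s)
            = - (h *\<^sub>R (?P - Dser f s))"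
          unfolding scaleR_right_diff_distrib scaleR_sum_right by (simp add: sum_negf)
        also have "norm \<dots> = \<bar>h\<bar> * dist ?P (Dser f s)" by (simp add: dist_norm)
        also have "\<dots> \<le> \<bar>h\<bar> * e" using elim \<open>s \<in> S\<close> by (intro mult_left_mono) force+
        finally show "norm ((\<Sum>n<N. h *\<^sub>R (- (f n * of_real (ln (real n) * real n powr - s))))
          - h *\<^sub>R (- Dser f s)) \<le> e * norm h" by (simp add: mult.commute)
      qed
    qed
  qed
  then obtain g where g: "\<And>s. s \<in> S \<Longrightarrow> (\<lambda>n. f n * of_real (real n powr - s)) sums g s"
      "\<And>s. s \<in> S \<Longrightarrow> (g has_derivative (\<lambda>h. h *\<^sub>R (- Dser f s))) (at s within S)" by blast
  have eq: "g s = Lser f s" if "s \<in> S" for s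
    using g(1)[OF that] by (simp add: Lser_def sums_iff)
  show "(\<lambda>n. f n * of_real (real n powr - s)) sums Lser f s" using g(1) eq \<open>s \<in> S\<close> by metis
  have "(g has_vector_derivative - Dser f s) (at s within S)"
    using g(2)[OF \<open>s \<in> S\<close>] by (simp add: has_vector_derivative_def)
  then show "(Lser f has_vector_derivative - Dser f s) (at s within S)"
    using has_vector_derivative_transform[OF \<open>s \<in> S\<close>, of "Lser f" g] eq by metis
qed

lemma Lser_has_vector_derivative:
  assumes f: "\<And>n. norm (f n) \<le> 1" and s: "s > 1"
  shows "(Lser f has_vector_derivative - Dser f s) (at s)"
proof -
  define t where "t = (1 + s) / 2"
  have t: "1 < t" "t < s" using s by (auto simp: t_def field_simps)
  have "uniform_limit {t<..} (\<lambda>N s. \<Sum>n<N. f n * of_real (ln (real n) * real n powr - s)) (Dser f) sequentially"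
    unfolding Dser_def
  proof (rule Weierstrass_m_test[OF _ summable_ln_powr[OF t(1)]])
    fix n s assume "s \<in> {t<..}"
    then have "ln (real n) * real n powr - s \<le> ln (real n) * real n powr - t"
      by (cases "n = 0") (auto intro!: mult_left_mono powr_mono)
    then show "norm (f n * of_real (ln (real n) * real n powr - s)) \<le> ln (real n) * real n powr - t"
      using norm_coeff_le[where f = f, OF f, of "ln (real n) * real n powr - s" n] ln_nat_nonneg[of n] by simp
  qed
  from Lser_has_derivative(2)[OF convex_real_interval(3) _
      summable_norm_cancel[OF summable_norm_Lser[where f = f, OF f s]] this, of s]
  have "(Lser f has_vector_derivative - Dser f s) (at s within {t<..})"
    using t(2) by simp
  moreover have "s \<in> {t<..}" using t(2) by simp
  ultimately show ?thesis using has_vector_derivative_within_open[OF _ open_greaterThan] by blast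
qed

text \<open>Split off the factor ln n / n, which decreases from e < 3 onwards; the other factor n^(1
  - s) decreases because s >= 1.\<close>

lemma ln_powr_antimono:
  assumes "s \<ge> 1" "n \<ge> 3"
  shows "ln (real (Suc n)) * real (Suc n) powr - s \<le> ln (real n) * real n powr - s"
proof -
  have e: "x * real n powr - s = x / n * real n powr (1 - s)" if "n > 0" for n x
    using that by (simp add: powr_diff powr_minus field_simps)
  have "exp 1 \<le> real n" using exp_le assms(2) by linarith
  then have "ln (real (Suc n)) / Suc n \<le> ln (real n) / n"
    using ln_x_over_x_mono[of "real n" "real (Suc n)"] by simp
  moreover have "real (Suc n) powr (1 - s) \<le> real n powr (1 - s)"
    using assms by (intro powr_mono2') auto
  ultimately have "ln (real (Suc n)) / Suc n * real (Suc n) powr (1 - s) \<le> ln (real n) / n * real n powr (1 - s)"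
    using assms by (intro mult_mono) auto
  then show ?thesis using e[of "Suc n"] e[of n] assms by simp
qed

section \<open>Coefficients with bounded partial sums: the series up to s = 1\<close>

context
  fixes f :: "nat \<Rightarrow> complex" and K :: real
  assumes f: "\<And>n. norm (f n) \<le> 1" and K: "\<And>N. norm (\<Sum>n<N. f n) \<le> K"
begin

lemma partial_sum_bound_nonneg: "K \<ge> 0" using K[of 0] by simp

text \<open>The bound is free of \<open>s\<close> and tends to 0 with growing \<open>M\<close>; this
  is what makes the convergence uniform on \<open>{1..}\<close>.\<close>

lemma norm_Dser_segment_le:
  assumes "s \<ge> 1" "M \<ge> 3"
  shows "norm (\<Sum>n=M..<N. f n * of_real (ln (real n) * real n powr - s)) \<le> 2 * K * (ln M / M)"
proof -
  have "norm (\<Sum>n=M..<N. f n * of_real (ln (real n) * real n powr - s)) \<le> 2 * K * (ln (real M) * real M powr - s)"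
    by (rule norm_sum_mult_antimono_le[OF K]) (use ln_powr_antimono[OF assms(1)] assms ln_nat_nonneg in auto)
  also have "2 * K * (ln (real M) * real M powr - s) \<le> 2 * K * (ln M / M)"
    using assms partial_sum_bound_nonneg ln_nat_nonneg[of M] powr_mono[of "- s" "- 1" "real M"]
    by (intro mult_left_mono) (auto simp: powr_minus divide_inverse intro!: mult_left_mono)
  finally show ?thesis .
qed

lemma Dser_uniform_limit:
  "uniform_limit {1..} (\<lambda>N s. \<Sum>n<N. f n * of_real (ln (real n) * real n powr - s)) (Dser f) sequentially"
proof -
  let ?P = "\<lambda>N s. \<Sum>n<N. f n * of_real (ln (real n) * real n powr - s)"
  have lim: "((\<lambda>M::nat. 2 * K * (ln M / M)) \<longlongrightarrow> 2 * K * 0) sequentially"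
    by (intro tendsto_intros filterlim_compose[OF ln_x_over_x_tendsto_0 filterlim_real_sequentially])
  have "uniformly_Cauchy_on {1..} ?P"
  proof (rule uniformly_Cauchy_onI')
    fix e :: real assume "e > 0"
    then have "\<forall>\<^sub>F M::nat in sequentially. 2 * K * (ln M / M) < e"
      using order_tendstoD(2)[OF lim] by simp
    then obtain M0 :: nat where M0: "\<And>M::nat. M \<ge> M0 \<Longrightarrow> 2 * K * (ln M / M) < e"
      by (auto simp: eventually_sequentially)
    show "\<exists>M. \<forall>s\<in>{1..}. \<forall>m\<ge>M. \<forall>n>m. dist (?P m s) (?P n s) < e"
    proof (intro exI[of _ "max M0 3"] ballI allI impI)
      fix s :: real and m n :: nat assume *: "s \<in> {1..}" "m \<ge> max M0 3" "n > m"
      have "?P n s - ?P m s = (\<Sum>n=m..<n. f n * of_real (ln (real n) * real n powr - s))"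
        unfolding lessThan_atLeast0 using sum_diff_nat_ivl[of 0 m n "\<lambda>n. f n * of_real (ln (real n) * real n powr - s)"] * by simp
      then have "norm (?P n s - ?P m s) \<le> 2 * K * (ln m / m)"
        using norm_Dser_segment_le[of s m n] * by simp
      also have "\<dots> < e" using M0 * by simp
      finally show "dist (?P m s) (?P n s) < e" by (simp add: dist_norm norm_minus_commute)
    qed
  qed
  from Cauchy_uniformly_convergent[OF this] show ?thesis
    unfolding uniformly_convergent_uniform_limit_iff Dser_def suminf_eq_lim .
qed

text \<open>Supplies the single point of convergence from which termwise differentiation yields
  convergence for all s >= 1.\<close>

lemma summable_Lser_1: "summable (\<lambda>n. f n * of_real (real n powr - 1))"
proof -
  have lim: "(\<lambda>M::nat. 2 * K * (1 / M)) \<longlonglongrightarrow> 2 * K * 0"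
    by (intro tendsto_intros lim_1_over_n)
  show ?thesis
  proof (rule summable_Cauchy[THEN iffD2], intro allI impI)
    fix e :: real assume "e > 0"
    then have "\<forall>\<^sub>F M::nat in sequentially. 2 * K * (1 / M) < e"
      using order_tendstoD(2)[OF lim] by simp
    then obtain M0 :: nat where M0: "\<And>M::nat. M \<ge> M0 \<Longrightarrow> 2 * K * (1 / M) < e"
      by (auto simp: eventually_sequentially)
    show "\<exists>N. \<forall>m\<ge>N. \<forall>n. norm (\<Sum>n=m..<n. f n * of_real (real n powr - 1)) < e"
    proof (intro exI[of _ "max M0 1"] allI impI)
      fix m n :: nat assume m: "m \<ge> max M0 1"
      have "norm (\<Sum>n=m..<n. f n * of_real (real n powr - 1)) \<le> 2 * K * (real m powr - 1)"
        by (rule norm_sum_mult_antimono_le[OF K]) (use m in \<open>auto intro!: powr_mono2' frac_le simp del: powr_neg_one\<close>)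
      also have "\<dots> < e" using M0[of m] m by (simp add: powr_minus field_simps)
      finally show "norm (\<Sum>n=m..<n. f n * of_real (real n powr - 1)) < e" .
    qed
  qed
qed

lemma Lser_has_vector_derivative_ge_1:
  assumes "s \<ge> 1"
  shows "(\<lambda>n. f n * of_real (real n powr - s)) sums Lser f s"
    and "(Lser f has_vector_derivative - Dser f s) (at s within {1..})"
  using Lser_has_derivative[OF convex_real_interval(1) _ summable_Lser_1 Dser_uniform_limit, of s] assms by auto

text \<open>The terms 0 and 1 vanish since ln 1 = 0, the term 2 is at most 1, and from 3 on the
  weights decrease, so Abel summation gives at most 2 K.\<close>

lemma norm_Dser_le:
  assumes "s \<ge> 1"
  shows "norm (Dser f s) \<le> 2 + 2 * K"
proof -
  let ?t = "\<lambda>n. f n * of_real (ln (real n) * real n powr - s)"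
  have lim: "(\<lambda>N. \<Sum>n<N. ?t n) \<longlonglongrightarrow> Dser f s"
    using tendsto_uniform_limitI[OF Dser_uniform_limit, of s] assms by simp
  have "\<forall>\<^sub>F N in sequentially. norm (\<Sum>n<N. ?t n) \<le> 2 + 2 * K"
    using eventually_ge_at_top[of 3]
  proof eventually_elim
    case (elim N)
    have "(\<Sum>n<N. ?t n) = ?t 2 + (\<Sum>n=3..<N. ?t n)"
      unfolding lessThan_atLeast0 using elim
      by (subst sum.atLeastLessThan_concat[symmetric, of 0 3]) (auto simp: numeral_3_eq_3 numeral_2_eq_2)
    moreover have "norm (?t 2) \<le> ln 2 * 2 powr - s"
      using norm_coeff_le[where f = f, OF f, of "ln (real 2) * real 2 powr - s" 2] by simp
    moreover have "ln 2 * 2 powr - s \<le> 1 * (1::real)"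
      using powr_mono[of "- s" 0 2] assms ln_2_less_1 by (intro mult_mono) auto
    moreover have "ln (3::real) / 3 \<le> 1" using ln_le_minus_one[of 3] by simp
    then have "2 * K * (ln (real 3) / real 3) \<le> 2 * K * 1" using partial_sum_bound_nonneg by (intro mult_left_mono) auto
    then have "norm (\<Sum>n=3..<N. ?t n) \<le> 2 * K" using norm_Dser_segment_le[of s 3 N] assms by simp
    ultimately show ?case using norm_triangle_ineq[of "?t 2" "\<Sum>n=3..<N. ?t n"]
      by (simp only: mult_1)
  qed
  then show ?thesis using tendsto_upperbound[OF tendsto_norm[OF lim]] by simp
qed

text \<open>Mean value inequality. If \<open>Lser f 1 = 0\<close>, it says that L decays at least
  linearly at 1, which is how a zero is weighed against a pole.\<close>

lemma norm_Lser_diff_le: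
  assumes "s \<ge> 1"
  shows "norm (Lser f s - Lser f 1) \<le> (2 + 2 * K) * (s - 1)"
proof -
  have "norm (Lser f s - Lser f 1) \<le> (2 + 2 * K) * norm (s - 1)"
  proof (rule differentiable_bound[of "{1..}" "Lser f" "\<lambda>s h. h *\<^sub>R (- Dser f s)"])
    fix s :: real assume "s \<in> {1..}"
    then show "(Lser f has_derivative (\<lambda>h. h *\<^sub>R (- Dser f s))) (at s within {1..})"
      using Lser_has_vector_derivative_ge_1(2) by (auto simp: has_vector_derivative_def)
    show "onorm (\<lambda>h::real. h *\<^sub>R (- Dser f s)) \<le> 2 + 2 * K"
      using norm_Dser_le[of s] \<open>s \<in> {1..}\<close>
      by (intro onorm_le) (simp add: mult.commute mult_left_mono)
  qed (use assms in auto)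
  then show ?thesis using assms by simp
qed

end

section \<open>Dirichlet products and the logarithmic derivative\<close>

lemma has_sum_product_abs:
  fixes f g :: "'a \<Rightarrow> complex"
  assumes f: "(f has_sum a) A" "(\<lambda>x. norm (f x)) summable_on A" and g: "(g has_sum b) B" "(\<lambda>x. norm (g x)) summable_on B"
  shows "((\<lambda>(x, y). f x * g y) has_sum (a * b)) (A \<times> B)"
proof (rule has_sum_SigmaI)
  show "((\<lambda>y. case (x, y) of (x, y) \<Rightarrow> f x * g y) has_sum f x * b) B" for x
    using has_sum_cmult_right[OF g(1)] by simp
  show "((\<lambda>x. f x * b) has_sum (a * b)) A" using has_sum_cmult_left[OF f(1)] .
  have "(\<lambda>z. norm (case z of (x, y) \<Rightarrow> f x * g y)) summable_on (A \<times> B)"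
  proof (subst Infinite_Sum.abs_summable_on_Sigma_iff, intro conjI ballI)
    show "(\<lambda>y. norm (case (x, y) of (x, y) \<Rightarrow> f x * g y)) summable_on B" for x
      using summable_on_cmult_right[OF g(2), of "norm (f x)"] by (simp add: norm_mult)
    have "(\<lambda>x. norm (f x) * infsum (\<lambda>y. norm (g y)) B) summable_on A"
      by (rule summable_on_cmult_left[OF f(2)])
    then show "(\<lambda>x. norm (\<Sum>\<^sub>\<infinity>y\<in>B. norm (case (x, y) of (x, y) \<Rightarrow> f x * g y))) summable_on A"
      by (simp add: norm_mult infsum_cmult_right' abs_mult infsum_nonneg)
  qed
  then show "(\<lambda>(x, y). f x * g y) summable_on A \<times> B" by (rule abs_summable_summable)
qed

text \<open>Regroups pairs (d, m) by their product N = d m. Used twice: for the Dirichlet product of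
  F and L, and to turn a Lambert series into a power series.\<close>

lemma has_sum_divisors:
  fixes h :: "nat \<times> nat \<Rightarrow> complex"
  assumes "(h has_sum S) ({1..} \<times> {1..})"
  shows "((\<lambda>N. \<Sum>d | d dvd N. h (d, N div d)) has_sum S) {1..}"
proof -
  have "((\<lambda>(N, d). h (d, N div d)) has_sum S) (Sigma {1..} (\<lambda>N. {d. d dvd N}))"
    by (rule has_sum_reindex_bij_witness[where i = "\<lambda>(d, m). (d * m, d)" and j = "\<lambda>(N, d). (d, N div d)",
          THEN iffD2, OF _ _ _ _ _ refl assms])
      (auto simp: Suc_le_eq elim!: dvdE)
  from has_sum_SigmaD[OF this, of "\<lambda>N. \<Sum>d | d dvd N. h (d, N div d)"] show ?thesis
    by (auto intro!: has_sum_finiteI)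
qed

lemma sums_imp_has_sum_from_1:
  fixes f :: "nat \<Rightarrow> complex"
  assumes "summable (\<lambda>n. norm (f n))" "f sums S" "f 0 = 0"
  shows "(f has_sum S) {1..}" "(\<lambda>x. norm (f x)) summable_on {1..}"
proof -
  have "(f has_sum S) UNIV" by (rule norm_summable_imp_has_sum[OF assms(1,2)])
  then show "(f has_sum S) {1..}"
    by (subst has_sum_cong_neutral[of UNIV _ f f S]) (auto simp: not_le assms(3))
  have "(\<lambda>x. norm (f x)) summable_on UNIV" using norm_summable_imp_summable_on[of "\<lambda>n. norm (f n)"] assms(1) by simp
  then show "(\<lambda>x. norm (f x)) summable_on {1..}" by (rule summable_on_subset_banach) auto
qed

text \<open>By complete multiplicativity the coefficient at N is \<psi>(N) times the sum of
  \<open>mangoldt\<close> over the divisors of N, which is ln N.\<close>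

lemma Lser_mult_Fser:
  assumes \<psi>: "\<psi> \<in> dcharacters q" and "q > 0" "s > 1"
  shows "Lser \<psi> s * Fser \<psi> s = Dser \<psi> s"
proof -
  have f: "norm (\<psi> n) \<le> 1" for n using dcharacters_norm_le[OF \<psi> \<open>q > 0\<close>] .
  let ?l = "\<lambda>n. \<psi> n * complex_of_real (real n powr - s)"
  let ?v = "\<lambda>n. \<psi> n * complex_of_real (mangoldt n * real n powr - s)"
  let ?d = "\<lambda>n. \<psi> n * complex_of_real (ln (real n) * real n powr - s)"
  note sl = summable_norm_Lser[where f = \<psi>, OF f \<open>s > 1\<close>]
  note sv = summable_norm_Fser[where f = \<psi>, OF f \<open>s > 1\<close>]
  note sd = summable_norm_Dser[where f = \<psi>, OF f \<open>s > 1\<close>]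
  have l: "?l sums Lser \<psi> s" and v: "?v sums Fser \<psi> s" and d: "?d sums Dser \<psi> s"
    unfolding Lser_def Dser_def Fser_def
    by (rule summable_norm_cancel[THEN summable_sums, OF sl] summable_norm_cancel[THEN summable_sums, OF sv]
        summable_norm_cancel[THEN summable_sums, OF sd])+
  have "((\<lambda>(x, y). ?v x * ?l y) has_sum Fser \<psi> s * Lser \<psi> s) ({1..} \<times> {1..})"
    using sums_imp_has_sum_from_1[OF sv v] sums_imp_has_sum_from_1[OF sl l]
    by (intro has_sum_product_abs) simp_all
  from has_sum_divisors[OF this]
  have "((\<lambda>N. \<Sum>d | d dvd N. ?v d * ?l (N div d)) has_sum Fser \<psi> s * Lser \<psi> s) {1..}" by simp
  also have "?this \<longleftrightarrow> (?d has_sum Fser \<psi> s * Lser \<psi> s) {1..}"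
  proof (rule has_sum_cong)
    fix N :: nat assume "N \<in> {1..}"
    then have N: "N > 0" by simp
    have "(\<Sum>d | d dvd N. ?v d * ?l (N div d)) = (\<Sum>d | d dvd N. \<psi> N * of_real (real N powr - s) * mangoldt d)"
    proof (rule sum.cong[OF refl])
      fix d assume "d \<in> {d. d dvd N}"
      then obtain m where m: "N = d * m" by auto
      then have "d > 0" "m > 0" using N by auto
      then show "?v d * ?l (N div d) = \<psi> N * of_real (real N powr - s) * mangoldt d"
        using dcharactersD(2)[OF \<psi>, of d m] by (simp add: m powr_mult)
    qed
    also have "\<dots> = ?d N" unfolding sum_distrib_left[symmetric] using mangoldt_sum[of N, where 'a = complex] N by simp
    finally show "(\<Sum>d | d dvd N. ?v d * ?l (N div d)) = ?d N" .
  qed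
  finally have "(?d has_sum Fser \<psi> s * Lser \<psi> s) {1..}" .
  moreover have "(?d has_sum Dser \<psi> s) {1..}"
    by (rule sums_imp_has_sum_from_1[OF sd d]) simp
  ultimately show ?thesis using has_sum_unique[of ?d] by (simp add: mult.commute)
qed

text \<open>The part of the \<open>mangoldt\<close> series over the class inverse to
  \<open>c\<close>. Stating the condition as c n = 1 lets orthogonality act directly on \<psi>(c n).
  The choice c = 1 gives the monotone product, c inverse to \<open>a\<close> gives the primes in the
  class of \<open>a\<close>.\<close>

definition Gser :: "nat \<Rightarrow> nat \<Rightarrow> real \<Rightarrow> real" where
  "Gser q c s = (\<Sum>n. if [c * n = 1] (mod q) then mangoldt n * real n powr - s else 0)"

lemma summable_Gser:
  "s > 1 \<Longrightarrow> summable (\<lambda>n. if [c * n = 1] (mod q) then mangoldt n * real n powr - s else (0::real))"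
  by (rule summable_comparison_test'[OF summable_mangoldt_powr, of s 0]) (auto simp: mangoldt_nonneg abs_mult)

lemma Gser_nonneg: "s > 1 \<Longrightarrow> Gser q c s \<ge> 0"
  unfolding Gser_def by (rule suminf_nonneg[OF summable_Gser]) (auto simp: mangoldt_nonneg)

lemma sum_dcharacters_Fser:
  assumes "q > 0" "s > 1"
  shows "(\<Sum>\<psi>\<in>dcharacters q. \<psi> c * Fser \<psi> s) = of_real (real (card (dcharacters q)) * Gser q c s)"
proof -
  have "(\<lambda>n. \<Sum>\<psi>\<in>dcharacters q. \<psi> c * (\<psi> n * complex_of_real (mangoldt n * real n powr - s))) sums
      (\<Sum>\<psi>\<in>dcharacters q. \<psi> c * Fser \<psi> s)"
  proof (intro sums_sum sums_mult)
    fix \<psi> assume "\<psi> \<in> dcharacters q"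
    then show "(\<lambda>n. \<psi> n * complex_of_real (mangoldt n * real n powr - s)) sums Fser \<psi> s"
      unfolding Fser_def
      by (intro summable_norm_cancel[THEN summable_sums, OF summable_norm_Fser[OF _ \<open>s > 1\<close>]]
          dcharacters_norm_le[OF _ \<open>q > 0\<close>])
  qed
  moreover have "(\<Sum>\<psi>\<in>dcharacters q. \<psi> c * (\<psi> n * complex_of_real (mangoldt n * real n powr - s))) =
      of_real (real (card (dcharacters q)) * (if [c * n = 1] (mod q) then mangoldt n * real n powr - s else 0))" for n
  proof -
    have "(\<Sum>\<psi>\<in>dcharacters q. \<psi> c * (\<psi> n * complex_of_real (mangoldt n * real n powr - s))) =
       (\<Sum>\<psi>\<in>dcharacters q. \<psi> (c * n)) * complex_of_real (mangoldt n * real n powr - s)"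
      unfolding sum_distrib_right by (intro sum.cong) (auto simp: dcharactersD(2))
    then show ?thesis unfolding sum_dcharacters[OF \<open>q > 0\<close>] by auto
  qed
  moreover have "(\<lambda>n. complex_of_real (real (card (dcharacters q)) * (if [c * n = 1] (mod q) then mangoldt n * real n powr - s else 0)))
      sums of_real (real (card (dcharacters q)) * Gser q c s)"
    unfolding Gser_def by (intro sums_of_real sums_mult summable_sums summable_Gser \<open>s > 1\<close>)
  ultimately show ?thesis using sums_unique2 by force
qed

section \<open>Non-vanishing at 1 for non-real characters\<close>

lemma DERIV_prod_log:
  fixes u :: "'a \<Rightarrow> real \<Rightarrow> real"
  assumes "finite A" "\<And>i. i \<in> A \<Longrightarrow> (u i has_real_derivative c i * u i s) (at s)"
  shows "((\<lambda>s. \<Prod>i\<in>A. u i s) has_real_derivative (\<Sum>i\<in>A. c i) * (\<Prod>i\<in>A. u i s)) (at s)"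
  using assms
proof (induction A rule: finite_induct)
  case (insert i A)
  then have "((\<lambda>s. u i s * (\<Prod>i\<in>A. u i s)) has_real_derivative
      c i * u i s * (\<Prod>i\<in>A. u i s) + (\<Sum>i\<in>A. c i) * (\<Prod>i\<in>A. u i s) * u i s) (at s)"
    by (intro DERIV_mult) auto
  then show ?case using insert by (simp add: algebra_simps)
qed simp

text \<open>The squared norm is differentiable even at zeros of L, and substituting L' = - L F into
  2 Re (cnj L * L') keeps it a factor of its own derivative.\<close>

lemma DERIV_norm_Lser_sq:
  assumes \<psi>: "\<psi> \<in> dcharacters q" and "q > 0" "s > 1"
  shows "((\<lambda>s. (norm (Lser \<psi> s))\<^sup>2) has_real_derivative - 2 * Re (Fser \<psi> s) * (norm (Lser \<psi> s))\<^sup>2) (at s)"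
proof -
  have d: "(Lser \<psi> has_derivative (\<lambda>h. h *\<^sub>R (- Dser \<psi> s))) (at s)"
    using Lser_has_vector_derivative[of \<psi> s] dcharacters_norm_le[OF \<psi> \<open>q > 0\<close>] \<open>s > 1\<close>
    by (simp add: has_vector_derivative_def)
  have eq: "Lser \<psi> s \<bullet> (h *\<^sub>R (- Dser \<psi> s)) + (h *\<^sub>R (- Dser \<psi> s)) \<bullet> Lser \<psi> s
      = - 2 * Re (Fser \<psi> s) * (norm (Lser \<psi> s))\<^sup>2 * h" for h
    unfolding Lser_mult_Fser[OF assms, symmetric] cmod_power2
    by (simp add: inner_complex_def power2_eq_square algebra_simps)
  show ?thesis
    using has_derivative_inner[OF d d] unfolding has_field_derivative_def eq
    by (simp only: power2_norm_eq_inner)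
qed

text \<open>The logarithmic derivative of the product is -2 times the sum of all Re F, and by
  orthogonality that sum is a nonnegative multiple of the series over n = 1 (mod q).\<close>

lemma prod_norm_Lser_antimono:
  assumes "q > 0" "1 < s" "s \<le> t"
  shows "(\<Prod>\<psi>\<in>dcharacters q. (norm (Lser \<psi> t))\<^sup>2) \<le> (\<Prod>\<psi>\<in>dcharacters q. (norm (Lser \<psi> s))\<^sup>2)"
proof (rule DERIV_nonpos_imp_nonincreasing[OF \<open>s \<le> t\<close>])
  fix x assume "s \<le> x" "x \<le> t"
  then have x: "x > 1" using \<open>1 < s\<close> by simp
  let ?P = "\<lambda>x. \<Prod>\<psi>\<in>dcharacters q. (norm (Lser \<psi> x))\<^sup>2"
  have "(?P has_real_derivative (\<Sum>\<psi>\<in>dcharacters q. - 2 * Re (Fser \<psi> x)) * ?P x) (at x)"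
    by (rule DERIV_prod_log[OF finite_dcharacters[OF \<open>q > 0\<close>] DERIV_norm_Lser_sq[OF _ \<open>q > 0\<close> x]])
  moreover have "(\<Sum>\<psi>\<in>dcharacters q. Re (Fser \<psi> x)) = real (card (dcharacters q)) * Gser q 1 x"
  proof -
    have "(\<Sum>\<psi>\<in>dcharacters q. Re (Fser \<psi> x)) = Re (\<Sum>\<psi>\<in>dcharacters q. \<psi> 1 * Fser \<psi> x)"
      by (simp add: dcharactersD(1)[unfolded One_nat_def] cong: sum.cong)
    then show ?thesis by (simp add: sum_dcharacters_Fser[OF \<open>q > 0\<close> x])
  qed
  then have "(\<Sum>\<psi>\<in>dcharacters q. - 2 * Re (Fser \<psi> x)) \<le> 0"
    unfolding sum_distrib_left[symmetric] using Gser_nonneg[OF x] by simp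
  then have "(\<Sum>\<psi>\<in>dcharacters q. - 2 * Re (Fser \<psi> x)) * ?P x \<le> 0"
    by (intro mult_nonpos_nonneg prod_nonneg) auto
  ultimately show "\<exists>y. DERIV ?P x :> y \<and> y \<le> 0" by blast
qed

text \<open>An anchor to the right of 1 at which the nonincreasing product is positive. At s = 3 the
  terms n >= 2 are at most n^(-2) / 2, so their sum is at most (pi^2 / 6 - 1) / 2; pi < 4 makes this
  less than 5/6, too small to cancel the leading 1.\<close>

lemma Lser_3_nonzero:
  assumes f: "\<And>n. norm (f n) \<le> 1" and "f 1 = 1"
  shows "Lser f 3 \<noteq> 0"
proof -
  let ?t = "\<lambda>n. f n * complex_of_real (real n powr - 3)"
  have sm: "summable ?t" using summable_norm_cancel[OF summable_norm_Lser[where f = f, OF f]] by simp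
  have sq: "(\<lambda>n. 1 / (real n + 2)\<^sup>2) sums (pi\<^sup>2 / 6 - 1)"
    using sums_Suc_iff[of "\<lambda>n. 1 / (real n + 1)\<^sup>2" "pi\<^sup>2 / 6 - 1"] inverse_squares_sums by (simp add: add.commute)
  have "norm (\<Sum>n. ?t (n + 2)) \<le> (\<Sum>n. 1 / 2 * (1 / (real n + 2)\<^sup>2))"
  proof (rule norm_suminf_le)
    show "summable (\<lambda>n. 1 / 2 * (1 / (real n + 2)\<^sup>2))"
      using sums_summable[OF sq] by (rule summable_mult)
    fix n :: nat
    have "norm (?t (n + 2)) \<le> real (n + 2) powr - 3"
      using norm_coeff_le[where f = f, OF f] by simp
    also have "\<dots> = 1 / (real n + 2) * (1 / (real n + 2)\<^sup>2)"
      by (simp add: powr_minus powr_numeral divide_inverse power3_eq_cube power2_eq_square ac_simps)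
    also have "\<dots> \<le> 1 / 2 * (1 / (real n + 2)\<^sup>2)"
      by (intro mult_right_mono frac_le) auto
    finally show "norm (?t (n + 2)) \<le> 1 / 2 * (1 / (real n + 2)\<^sup>2)" .
  qed
  also have "\<dots> = 1 / 2 * (pi\<^sup>2 / 6 - 1)"
    using sums_unique[OF sums_mult[OF sq, of "1 / 2"]] by simp
  also have "\<dots> < 1"
    using power_strict_mono[OF pi_less_4, of 2] by simp
  finally have "norm (\<Sum>n. ?t (n + 2)) < 1" .
  moreover have "Lser f 3 = 1 + (\<Sum>n. ?t (n + 2))"
    unfolding Lser_def using suminf_split_initial_segment[OF sm, of 2] \<open>f 1 = 1\<close> by (simp add: numeral_2_eq_2)
  moreover have "norm (- 1 :: complex) = 1" by simp
  ultimately show ?thesis using add_eq_0_iff[of 1 "\<Sum>n. ?t (n + 2)"] by (metis less_irrefl)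
qed


text \<open>The integral test in discrete form: by the mean value theorem each term is dominated by
  a telescoping difference.\<close>

lemma powr_minus_le_diff:
  assumes "s > 1" "n \<ge> 2"
  shows "real n powr - s \<le> (real (n - 1) powr (1 - s) - real n powr (1 - s)) / (s - 1)"
proof -
  have "\<exists>z>real (n - 1). z < real n \<and>
      real n powr (1 - s) - real (n - 1) powr (1 - s) = (real n - real (n - 1)) * ((1 - s) * z powr (1 - s - 1))"
    by (rule MVT2) (use assms has_real_derivative_powr[of _ "1 - s"] in auto)
  then obtain z where z: "real (n - 1) < z" "z < real n"
      "real n powr (1 - s) - real (n - 1) powr (1 - s) = (real n - real (n - 1)) * ((1 - s) * z powr (1 - s - 1))"
    by blast
  then have eq: "real (n - 1) powr (1 - s) - real n powr (1 - s) = (s - 1) * z powr - s"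
    using assms by (simp add: of_nat_diff algebra_simps)
  have "real n powr - s \<le> z powr - s" using z assms by (intro powr_mono2') auto
  then show ?thesis using eq assms by simp
qed

lemma norm_Lser_le:
  assumes f: "\<And>n. norm (f n) \<le> 1" and s: "s > 1"
  shows "norm (Lser f s) \<le> 1 + 1 / (s - 1)"
proof -
  have part: "(\<Sum>n<N. real n powr - s) \<le> 1 + 1 / (s - 1)" for N
  proof (cases "N \<ge> 2")
    case True
    then have "(\<Sum>n<N. real n powr - s) \<le> 1 + (1 - real (N - 1) powr (1 - s)) / (s - 1)"
    proof (induction N rule: dec_induct)
      case (step N)
      then show ?case using powr_minus_le_diff[OF s step(1)]
        by (simp add: diff_divide_distrib)
    qed (simp add: numeral_2_eq_2)
    also have "\<dots> \<le> 1 + 1 / (s - 1)" using s by (intro add_left_mono divide_right_mono) auto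
    finally show ?thesis .
  next
    case False
    then have "(\<Sum>n<N. real n powr - s) = 0" by (intro sum.neutral) (auto simp: not_le less_Suc_eq numeral_2_eq_2)
    then show ?thesis using s by simp
  qed
  have "norm (Lser f s) \<le> (\<Sum>n. real n powr - s)"
    unfolding Lser_def using norm_coeff_le[where f = f, OF f]
    by (intro norm_suminf_le summable_powr_minus[OF s]) simp
  also have "\<dots> \<le> 1 + 1 / (s - 1)"
    using part by (intro suminf_le_const summable_powr_minus[OF s]) auto
  finally show ?thesis .
qed

lemma Lser_cnj:
  assumes "\<And>n. norm (f n) \<le> 1" "s > 1"
  shows "Lser (\<lambda>n. cnj (f n)) s = cnj (Lser f s)"
proof -
  have "(\<lambda>n. f n * of_real (real n powr - s)) sums Lser f s"
    unfolding Lser_def using summable_norm_Lser[of f s] assms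
    by (intro summable_norm_cancel[THEN summable_sums]) simp
  then have "(\<lambda>n. cnj (f n * of_real (real n powr - s))) sums cnj (Lser f s)" by (simp only: sums_cnj)
  then show ?thesis unfolding Lser_def by (simp add: sums_iff)
qed

lemma norm_Lser_diff_1_le:
  assumes "\<psi> \<in> dcharacters q" "\<psi> \<noteq> principal_character q" "q > 0" "s \<ge> 1"
  shows "norm (Lser \<psi> s - Lser \<psi> 1) \<le> (2 + 2 * real q) * (s - 1)"
  using norm_Lser_diff_le[OF dcharacters_norm_le[OF assms(1,3)] norm_sum_dcharacter_le[OF assms(1-3)] assms(4)] .

lemma Lser_1_nonzero_complex:
  assumes \<psi>: "\<psi> \<in> dcharacters q" "(\<lambda>n. cnj (\<psi> n)) \<noteq> \<psi>" and "q > 0"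
  shows "Lser \<psi> 1 \<noteq> 0"
proof
  assume zero: "Lser \<psi> 1 = 0"
  let ?\<phi> = "principal_character q" and ?C = "dcharacters q"
  define \<psi>' where "\<psi>' = (\<lambda>n. cnj (\<psi> n))"
  have \<psi>': "\<psi>' \<in> ?C" "\<psi>' \<noteq> \<psi>" using \<psi> dcharacters_cnj by (auto simp: \<psi>'_def)
  have cnj: "(\<lambda>n. cnj (?\<phi> n)) = ?\<phi>" by (auto simp: principal_character_def)
  have np1: "\<psi> \<noteq> ?\<phi>" using cnj \<psi>(2) by blast
  have "\<psi> = (\<lambda>n. cnj (\<psi>' n))" by (simp add: \<psi>'_def)
  then have np: "\<psi> \<noteq> ?\<phi>" "\<psi>' \<noteq> ?\<phi>" using np1 cnj by auto
  \<comment> \<open>One constant for all roles on (1, 2]: a bound for the non-principal factors, the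
    slope at the two zeros, and, through the summand 2, the pole, since 1 + 1/(s - 1) <= 2/(s -
    1).\<close>
  define K where "K = 2 + 2 * (2 + 2 * real q) + (\<Sum>\<psi>\<in>?C. norm (Lser \<psi> 1))"
  have K: "K \<ge> 2 + 2 * (2 + 2 * real q)" "K \<ge> 1" unfolding K_def by (simp_all add: sum_nonneg)
  have bnd: "norm (Lser \<theta> s) \<le> K" if "\<theta> \<in> ?C" "\<theta> \<noteq> ?\<phi>" "1 < s" "s \<le> 2" for \<theta> s
  proof -
    have "norm (Lser \<theta> s) \<le> norm (Lser \<theta> 1) + norm (Lser \<theta> s - Lser \<theta> 1)" by norm
    moreover have "(2 + 2 * real q) * (s - 1) \<le> (2 + 2 * real q) * 1" using that by (intro mult_left_mono) auto
    moreover have "norm (Lser \<theta> 1) \<le> (\<Sum>\<psi>\<in>?C. norm (Lser \<psi> 1))"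
      using that(1) finite_dcharacters[OF \<open>q > 0\<close>] by (intro member_le_sum) auto
    ultimately have "norm (Lser \<theta> s) \<le> (\<Sum>\<psi>\<in>?C. norm (Lser \<psi> 1)) + (2 + 2 * real q)"
      using norm_Lser_diff_1_le[OF that(1,2) \<open>q > 0\<close> less_imp_le[OF that(3)]] by argo
    then show ?thesis unfolding K_def by simp
  qed
  have bnd0: "norm (Lser \<psi> s) \<le> K * (s - 1)" "norm (Lser \<psi>' s) \<le> K * (s - 1)" if "1 < s" "s \<le> 2" for s
  proof -
    have "norm (Lser \<psi> s) \<le> (2 + 2 * real q) * (s - 1)"
      using norm_Lser_diff_1_le[OF \<psi>(1) np(1) \<open>q > 0\<close>, of s] zero that by simp
    also have "\<dots> \<le> K * (s - 1)" using K that by (intro mult_right_mono) auto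
    finally show *: "norm (Lser \<psi> s) \<le> K * (s - 1)" .
    have "Lser \<psi>' s = cnj (Lser \<psi> s)"
      unfolding \<psi>'_def by (rule Lser_cnj[OF dcharacters_norm_le[OF \<psi>(1) \<open>q > 0\<close>] that(1)])
    then show "norm (Lser \<psi>' s) \<le> K * (s - 1)" using * by simp
  qed
  have bnd1: "norm (Lser ?\<phi> s) \<le> K / (s - 1)" if "1 < s" "s \<le> 2" for s
  proof -
    have "norm (Lser ?\<phi> s) \<le> 1 + 1 / (s - 1)"
      by (rule norm_Lser_le[OF dcharacters_norm_le[OF principal_character_in \<open>q > 0\<close>] that(1)])
    also have "\<dots> \<le> 1 / (s - 1) + 1 / (s - 1)" using that by (intro add_right_mono) simp
    also have "\<dots> = 2 / (s - 1)" by simp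
    also have "\<dots> \<le> K / (s - 1)" using K that by (intro divide_right_mono) auto
    finally show ?thesis .
  qed
  let ?P = "\<lambda>s. \<Prod>\<theta>\<in>?C. (norm (Lser \<theta> s))\<^sup>2"
  define M where "M = (K\<^sup>2) ^ card ?C"
  have M: "M \<ge> 1" using K(2) by (simp add: M_def)
  have P_le: "?P s \<le> M * (s - 1)" if "1 < s" "s \<le> 2" for s
  proof -
    define t where "t = s - 1"
    have t: "0 < t" "t \<le> 1" using that by (auto simp: t_def)
    \<comment> \<open>The order of each squared factor in t = s - 1. One pole t^(-2) against two
      zeros t^2 leaves t^2 in the product, hence at most \<open>M * t\<close>.\<close>
    define B where "B \<theta> = (if \<theta> = ?\<phi> then (1 / t)\<^sup>2 else if \<theta> \<in> {\<psi>, \<psi>'} then t\<^sup>2 else 1)" for \<theta>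
    have "?P s \<le> (\<Prod>\<theta>\<in>?C. K\<^sup>2 * B \<theta>)"
    proof (rule prod_mono, intro conjI)
      fix \<theta> assume \<theta>: "\<theta> \<in> ?C"
      show "(norm (Lser \<theta> s))\<^sup>2 \<le> K\<^sup>2 * B \<theta>"
        using bnd[OF \<theta> _ that] bnd0[OF that] bnd1[OF that] np
        by (auto simp: B_def t_def[symmetric] power_mult_distrib[symmetric] simp del: power_mult_distrib power_one_over intro!: power_mono)
    qed simp
    also have "\<dots> = M * (\<Prod>\<theta>\<in>?C. B \<theta>)" by (simp add: prod.distrib M_def)
    also have "(\<Prod>\<theta>\<in>?C. B \<theta>) = (\<Prod>\<theta>\<in>{?\<phi>, \<psi>, \<psi>'}. B \<theta>)"
      using \<psi>(1) \<psi>'(1) principal_character_in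
      by (intro prod.mono_neutral_right finite_dcharacters \<open>q > 0\<close>) (auto simp: B_def)
    also have "\<dots> = t\<^sup>2" using np \<psi>'(2) t by (simp add: B_def power2_eq_square)
    also have "M * t\<^sup>2 \<le> M * t"
      using M t by (intro mult_left_mono) (auto simp: power2_eq_square mult_left_le)
    finally show ?thesis by (simp add: t_def)
  qed
  define p where "p = ?P 3"
  have "Lser \<theta> 3 \<noteq> 0" if "\<theta> \<in> ?C" for \<theta>
    by (rule Lser_3_nonzero[where f = \<theta>, OF dcharacters_norm_le[OF that \<open>q > 0\<close>] dcharactersD(1)[OF that]])
  then have "p > 0" unfolding p_def by (intro prod_pos) simp
  \<comment> \<open>Close enough to 1 that the product is at most p / 2, although monotonicity
    forces it to be at least its value \<open>p\<close> at 3.\<close>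
  define t where "t = min 1 (p / (2 * M))"
  have t: "0 < t" "t \<le> 1" "M * t \<le> p / 2" using M \<open>p > 0\<close> by (auto simp: t_def min_def field_simps)
  have "p \<le> ?P (1 + t)" unfolding p_def using t by (intro prod_norm_Lser_antimono \<open>q > 0\<close>) auto
  also have "\<dots> \<le> M * t" using P_le[of "1 + t"] t by simp
  finally show False using t(3) \<open>p > 0\<close> by simp
qed

section \<open>Dirichlet's theorem on primes in residue classes\<close>

text \<open>Exactly the inequality that makes the Lambert weights decrease: consecutive values of
  t^n / g(n), with g(n) the geometric sum, differ by t^n / (g(n) g(n+1)), to be compared with 1/n -
  1/(n+1).\<close>

lemma geometric_AM_GM:
  fixes t :: real
  assumes "0 \<le> t" "t \<le> 1"
  shows "real (n * (n + 1)) * t ^ n \<le> (\<Sum>i<n. t ^ i) * (\<Sum>i<Suc n. t ^ i)"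
proof (induction n)
  case (Suc n)
  let ?g = "\<lambda>n. \<Sum>i<n. t ^ i"
  have g: "?g (Suc n) = 1 + t * ?g n" for n
    unfolding sum.lessThan_Suc_shift by (simp add: sum_distrib_left)
  have "2 * real (n + 1) * t ^ (n + 1) = (\<Sum>i<Suc n. 2 * t ^ (n + 1))" by simp
  also have "\<dots> \<le> (\<Sum>i<Suc n. t ^ i + t ^ (n + 1) * t ^ (n - i))"
  proof (rule sum_mono)
    fix i assume "i \<in> {..<Suc n}"
    then obtain j where n: "n = i + j" using le_Suc_ex[of i n] by auto
    define u where "u = t ^ j"
    \<comment> \<open>AM-GM for t^i and t^(2n+1-i), whose geometric mean t^(n+1/2) is at least
      t^(n+1); the completed square avoids the half-integral exponent.\<close>
    have "0 \<le> (1 - t) + t * (1 - u)\<^sup>2" using assms by simp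
    also have "\<dots> = 1 + t * u * u - 2 * t * u" by (simp add: power2_eq_square algebra_simps)
    finally have "t ^ i * (2 * t * u) \<le> t ^ i * (1 + t * u * u)" using assms by (intro mult_left_mono) auto
    then show "2 * t ^ (n + 1) \<le> t ^ i + t ^ (n + 1) * t ^ (n - i)"
      by (simp add: n u_def power_add algebra_simps)
  qed
  also have "\<dots> = ?g (Suc n) + t ^ (n + 1) * ?g (Suc n)"
    unfolding sum.distrib sum_distrib_left[symmetric]
    using sum.nat_diff_reindex[of "\<lambda>i. t ^ i" "Suc n"] by simp
  finally have 1: "2 * real (n + 1) * t ^ (n + 1) \<le> ?g (Suc n) * (1 + t ^ (n + 1))" by (simp add: algebra_simps)
  have "real (Suc n * (Suc n + 1)) * t ^ Suc n = t * (real (n * (n + 1)) * t ^ n) + 2 * real (n + 1) * t ^ (n + 1)"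
    by (simp add: algebra_simps)
  also have "\<dots> \<le> t * (?g n * ?g (Suc n)) + ?g (Suc n) * (1 + t ^ (n + 1))"
    using assms Suc.IH 1 by (intro add_mono mult_left_mono) auto
  also have "\<dots> = ?g (Suc n) * (t * (?g n + t ^ n) + 1)" by (simp add: algebra_simps)
  also have "?g n + t ^ n = ?g (Suc n)" by simp
  also have "t * ?g (Suc n) + 1 = ?g (Suc (Suc n))" using g[of "Suc n"] by simp
  finally show ?case .
qed simp

lemma geometric_ge: "0 \<le> t \<Longrightarrow> t \<le> 1 \<Longrightarrow> real n * t ^ n \<le> (\<Sum>i<n. t ^ i)" for t :: real
  using sum_mono[of "{..<n}" "\<lambda>_. t ^ n" "\<lambda>i. t ^ i"] by (simp add: power_decreasing)

text \<open>As t tends to 1, t^n / (1 - t^n) grows like 1 / (n (1 - t)); subtracting it from that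
  leading part leaves decreasing weights with b(1) = 1 whatever t is.\<close>

lemma lambert_weight_antimono:
  fixes t :: real
  defines "b \<equiv> \<lambda>n. 1 / (1 - t) * (1 / real n) - t ^ n / (1 - t ^ n)"
  assumes t: "0 < t" "t < 1" and "n \<ge> 1"
  shows "0 \<le> b n" "b (Suc n) \<le> b n"
proof -
  let ?g = "\<lambda>n. \<Sum>i<n. t ^ i"
  have g: "?g (Suc n) = 1 + t * ?g n" for n
    unfolding sum.lessThan_Suc_shift by (simp add: sum_distrib_left)
  have pos: "?g n > 0" if "n \<ge> 1" for n
    using that t by (intro sum_pos) (auto simp: lessThan_empty_iff)
  have b: "b n = 1 / (1 - t) * (1 / n - t ^ n / ?g n)" if "n \<ge> 1" for n
  proof -
    have "1 - t ^ n = (1 - t) * ?g n" using one_diff_power_eq[of t n] by simp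
    then show ?thesis using pos[OF that] t by (simp add: b_def diff_divide_distrib right_diff_distrib)
  qed
  have "t ^ n / ?g n \<le> 1 / n"
    using geometric_ge[of t n] pos[OF \<open>n \<ge> 1\<close>] t \<open>n \<ge> 1\<close> by (simp add: field_simps)
  then show "0 \<le> b n" unfolding b[OF \<open>n \<ge> 1\<close>] using t by simp
  have pn: "?g n > 0" "?g (Suc n) > 0" using pos[of n] pos[of "Suc n"] \<open>n \<ge> 1\<close> by simp_all
  have "t ^ n / ?g n - t ^ Suc n / ?g (Suc n) = t ^ n * (?g (Suc n) - t * ?g n) / (?g n * ?g (Suc n))"
    using pn by (simp add: field_simps del: sum.lessThan_Suc)
  also have "\<dots> = t ^ n / (?g n * ?g (Suc n))" unfolding g by simp
  also have "\<dots> \<le> 1 / real (n * (n + 1))"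
  proof -
    have "a / P \<le> 1 / N" if "N * a \<le> P" "P > 0" "N > 0" for a P N :: real
      using that by (simp add: field_simps)
    then show ?thesis using geometric_AM_GM[of t n] pn t \<open>n \<ge> 1\<close> by (simp del: sum.lessThan_Suc of_nat_mult)
  qed
  also have "\<dots> = 1 / n - 1 / Suc n" using \<open>n \<ge> 1\<close> by (simp add: field_simps)
  finally have "1 / Suc n - t ^ Suc n / ?g (Suc n) \<le> 1 / n - t ^ n / ?g n" by simp
  then show "b (Suc n) \<le> b n" using b[of "Suc n"] b[of n] \<open>n \<ge> 1\<close> t
    by (simp add: divide_right_mono del: sum.lessThan_Suc)
qed

lemma sum_powers_nonneg:
  fixes y :: real
  assumes "y \<in> {-1, 0, 1}"
  shows "0 \<le> (\<Sum>i\<le>k. y ^ i)"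
proof (cases "y = -1")
  case True
  have "(\<Sum>i\<le>k. (-1) ^ i) = (if even k then 1 else (0::real))" by (induction k) auto
  then show ?thesis using True by simp
qed (use assms in \<open>auto intro: sum_nonneg\<close>)

text \<open>Each divisor of p^k m is uniquely p^i d with i <= k and d dividing m;
  \<open>multiplicity\<close> recovers i.\<close>

lemma sum_divisors_prime_power_mult:
  fixes x :: "nat \<Rightarrow> real"
  assumes p: "prime p" "\<not> p dvd m" "m > 0" and mult: "\<And>a b. x (a * b) = x a * x b" and "x 1 = 1"
  shows "(\<Sum>d | d dvd p ^ k * m. x d) = (\<Sum>i\<le>k. x p ^ i) * (\<Sum>d | d dvd m. x d)"
proof -
  have pow: "x (p ^ i) = x p ^ i" for i by (induction i) (use mult \<open>x 1 = 1\<close> in auto)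
  have "bij_betw (\<lambda>(i, d). p ^ i * d) ({..k} \<times> {d. d dvd m}) {d. d dvd p ^ k * m}"
    unfolding bij_betw_def
  proof (intro conjI inj_onI equalityI subsetI)
    fix u v assume *: "u \<in> {..k} \<times> {d. d dvd m}" "v \<in> {..k} \<times> {d. d dvd m}"
      "(case u of (i, d) \<Rightarrow> p ^ i * d) = (case v of (i, d) \<Rightarrow> p ^ i * d)"
    obtain i d j e where uv: "u = (i, d)" "v = (j, e)" by (cases u, cases v)
    have nd: "\<not> p dvd d" "\<not> p dvd e" using * uv p(2) dvd_trans by auto
    have "multiplicity p (p ^ i * d) = i" "multiplicity p (p ^ j * e) = j"
      using nd p(1) by (auto intro!: multiplicity_eqI simp: prime_gt_0_nat)
    then have "i = j" using * uv by simp
    then show "u = v" using * uv p(1) by (simp add: prime_gt_0_nat)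
  next
    fix z assume "z \<in> (\<lambda>(i, d). p ^ i * d) ` ({..k} \<times> {d. d dvd m})"
    then show "z \<in> {d. d dvd p ^ k * m}" by (auto intro!: mult_dvd_mono le_imp_power_dvd)
  next
    fix z assume "z \<in> {d. d dvd p ^ k * m}"
    then obtain a b where "z = a * b" "a dvd p ^ k" "b dvd m" using division_decomp by blast
    then show "z \<in> (\<lambda>(i, d). p ^ i * d) ` ({..k} \<times> {d. d dvd m})"
      using divides_primepow_nat[OF p(1), of a k] by force
  qed
  from sum.reindex_bij_betw[OF this, of x, symmetric]
  show ?thesis by (simp add: case_prod_beta mult pow sum_product sum.cartesian_product)
qed

text \<open>Splitting off full prime powers factors the sum into pieces 1 + y + ... + y^k with y in
  {-1, 0, 1}, none of which is negative.\<close>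

lemma sum_divisors_nonneg:
  fixes x :: "nat \<Rightarrow> real"
  assumes mult: "\<And>a b. x (a * b) = x a * x b" and "x 1 = 1" and vals: "\<And>n. x n \<in> {-1, 0, 1}"
    and "n > 0"
  shows "0 \<le> (\<Sum>d | d dvd n. x d)"
  using \<open>n > 0\<close>
proof (induction n rule: less_induct)
  case (less n)
  show ?case
  proof (cases "n = 1")
    case True
    then show ?thesis using \<open>x 1 = 1\<close> by simp
  next
    case False
    then obtain p where p: "prime p" "p dvd n" using prime_factor_nat by blast
    obtain m where m: "n = p ^ multiplicity p n * m" "\<not> p dvd m"
      using multiplicity_decompose'[of n p] p(1) less.prems not_prime_unit by (metis less_numeral_extra(3))
    have "m > 0" using m(1) less.prems by (cases m) auto
    have "multiplicity p n > 0" using p less.prems by (simp add: prime_multiplicity_gt_zero_iff)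
    then have "1 < p ^ multiplicity p n" using prime_gt_1_nat[OF p(1)] using one_less_power by blast
    then have "m < n" using m(1) \<open>m > 0\<close> by (metis mult_less_cancel2 nat_mult_1)
    show ?thesis
      using sum_divisors_prime_power_mult[where x = x, OF p(1) m(2) \<open>m > 0\<close> mult \<open>x 1 = 1\<close>, of "multiplicity p n"]
        less.IH[OF \<open>m < n\<close> \<open>m > 0\<close>] sum_powers_nonneg[OF vals, of p "multiplicity p n"] m(1)
      by simp
  qed
qed


text \<open>Absolute summability of the double series in (n, k) is the point: summing over k first
  gives the Lambert series, and grouping by n k later gives a power series with the same value
  \<open>S\<close>.\<close>

lemma lambert_has_sum:
  fixes t :: real
  assumes f: "\<And>n. norm (f n) \<le> 1" and t: "0 < t" "t < 1"
  shows "\<exists>S. ((\<lambda>(n, k). f n * complex_of_real (t ^ (n * k))) has_sum S) ({1..} \<times> {1..}) \<and>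
    (\<lambda>n. f n * of_real (t ^ n / (1 - t ^ n))) sums S"
proof -
  let ?h = "\<lambda>(n, k). f n * complex_of_real (t ^ (n * k))"
  have tn: "t ^ n < 1" "t ^ n \<le> t" if "n \<ge> 1" for n
    using t power_decreasing[of 1 n t] that by (auto simp: power_less_one_iff)
  have geo: "((\<lambda>k. norm (?h (n, k))) has_sum norm (f n) * (t ^ n / (1 - t ^ n))) {1..}" if "n \<ge> 1" for n
    using has_sum_cmult_right[OF has_sum_geometric_from_1[of "t ^ n"], of "norm (f n)"] tn[OF that] t
    by (simp add: norm_mult norm_power power_mult)
  have "(\<lambda>z. norm (?h z)) summable_on ({1..} \<times> {1..})"
  proof (subst Infinite_Sum.abs_summable_on_Sigma_iff, intro conjI ballI)
    fix n :: nat assume "n \<in> {1..}"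
    then show "(\<lambda>k. norm (?h (n, k))) summable_on {1..}" using geo has_sum_imp_summable by fastforce
  next
    have "(\<lambda>n. t ^ n / (1 - t)) summable_on {1..}"
      using has_sum_geometric_from_1[of t] t
      by (intro has_sum_imp_summable[OF has_sum_divide_const]) auto
    then show "(\<lambda>n. norm (\<Sum>\<^sub>\<infinity>k\<in>{1..}. norm (?h (n, k)))) summable_on {1..}"
    proof (rule Infinite_Sum.summable_on_comparison_test)
      fix n :: nat assume "n \<in> {1..}"
      then have n: "n \<ge> 1" by simp
      have "(\<Sum>\<^sub>\<infinity>k\<in>{1..}. norm (?h (n, k))) = norm (f n) * (t ^ n / (1 - t ^ n))"
        using infsumI[OF geo[OF n]] .
      also have "norm \<dots> \<le> 1 * (t ^ n / (1 - t))"
        unfolding norm_mult using f[of n] tn[OF n] t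
        by (auto simp: abs_mult intro!: mult_mono frac_le)
      finally show "norm (\<Sum>\<^sub>\<infinity>k\<in>{1..}. norm (?h (n, k))) \<le> t ^ n / (1 - t)" by simp
    qed simp
  qed
  then have "?h summable_on ({1..} \<times> {1..})" by (rule abs_summable_summable)
  then obtain S where S: "(?h has_sum S) ({1..} \<times> {1..})" using summable_on_def by blast
  have "((\<lambda>n. f n * of_real (t ^ n / (1 - t ^ n))) has_sum S) {1..}"
  proof (rule has_sum_SigmaD[OF S])
    fix n :: nat assume "n \<in> {1..}"
    then have "norm (complex_of_real (t ^ n)) < 1" using tn[of n] t by (simp add: norm_power)
    from has_sum_cmult_right[OF has_sum_geometric_from_1[OF this], of "f n"]
    show "((\<lambda>k. ?h (n, k)) has_sum f n * of_real (t ^ n / (1 - t ^ n))) {1..}"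
      by (simp add: power_mult)
  qed
  then have "((\<lambda>n. f n * of_real (t ^ n / (1 - t ^ n))) has_sum S) UNIV"
    by (rule has_sum_cong_neutral[THEN iffD1, rotated -1]) (auto simp: not_le)
  then show ?thesis using S has_sum_imp_sums by blast
qed

text \<open>If L(1) = 0, subtracting the Lambert series from 1/(1 - t) times the vanishing series
  \<psi>(n) / n leaves - S, and Abel summation bounds it by 2 q b(1) = 2 q, uniformly in t.\<close>

lemma lambert_norm_le:
  fixes t :: real
  assumes \<psi>: "\<psi> \<in> dcharacters q" "\<psi> \<noteq> principal_character q" and "q > 0"
    and zero: "Lser \<psi> 1 = 0" and t: "0 < t" "t < 1"
    and S: "(\<lambda>n. \<psi> n * of_real (t ^ n / (1 - t ^ n))) sums S"
  shows "norm S \<le> 2 * real q"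
proof -
  let ?b = "\<lambda>n. 1 / (1 - t) * (1 / real n) - t ^ n / (1 - t ^ n)"
  have "(\<lambda>n. \<psi> n * of_real (real n powr - 1)) sums 0"
    using Lser_has_vector_derivative_ge_1(1)[OF dcharacters_norm_le[OF \<psi>(1) \<open>q > 0\<close>]
        norm_sum_dcharacter_le[OF assms(1-3)], of 1] zero by simp
  from sums_diff[OF sums_mult[OF this, of "of_real (1 / (1 - t))"] S]
  have "(\<lambda>n. \<psi> n * of_real (?b n)) sums (- S)"
    by (simp add: powr_minus divide_inverse algebra_simps)
  moreover have "\<psi> 0 * of_real (?b 0) = 0" by simp
  ultimately have lim: "(\<lambda>N. \<Sum>n=1..<N. \<psi> n * of_real (?b n)) \<longlonglongrightarrow> - S"
    unfolding sums_def lessThan_atLeast0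
    by (elim Lim_transform_eventually, intro eventually_sequentiallyI[of 1])
      (simp add: sum.atLeast_Suc_lessThan)
  have "norm (\<Sum>n=1..<N. \<psi> n * of_real (?b n)) \<le> 2 * real q" for N
  proof -
    have "norm (\<Sum>n=1..<N. \<psi> n * of_real (?b n)) \<le> 2 * real q * ?b 1"
      by (rule norm_sum_mult_antimono_le[OF norm_sum_dcharacter_le[OF assms(1-3)]])
        (use lambert_weight_antimono[OF t] in auto)
    also have "?b 1 = 1" using t by (simp add: field_simps)
    finally show ?thesis by simp
  qed
  then have "norm (- S) \<le> 2 * real q" by (intro tendsto_upperbound[OF tendsto_norm[OF lim]]) auto
  then show ?thesis by simp
qed

text \<open>The power series of the Lambert sum has coefficients \<open>c N\<close> >= 0, with value
  1 at every power of \<open>q\<close>. Near t = 1 these powers alone exceed any bound, against the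
  uniform bound 2 q.\<close>

lemma Lser_1_nonzero_real:
  assumes \<psi>: "\<psi> \<in> dcharacters q" "\<psi> \<noteq> principal_character q" and "q > 0"
    and real: "(\<lambda>n. cnj (\<psi> n)) = \<psi>"
  shows "Lser \<psi> 1 \<noteq> 0"
proof
  assume zero: "Lser \<psi> 1 = 0"
  define x where "x n = Re (\<psi> n)" for n
  have x: "\<psi> n = of_real (x n)" for n
    using fun_cong[OF real, of n] by (simp add: x_def complex_eq_iff)
  have vals: "x n \<in> {-1, 0, 1}" for n
    using dcharacters_norm_coprime[OF \<psi>(1) _ \<open>q > 0\<close>, of n] dcharactersD(4)[OF \<psi>(1), of n]
    by (cases "coprime n q") (auto simp: x abs_if split: if_splits)
  have mult: "x (a * b) = x a * x b" and x1: "x 1 = 1" for a b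
    using dcharactersD(1)[OF \<psi>(1)] dcharactersD(2)[OF \<psi>(1), of a b] unfolding x
    by (simp_all flip: of_real_mult)
  define c where "c N = (\<Sum>d | d dvd N. x d)" for N
  have c_nonneg: "c N \<ge> 0" if "N \<ge> 1" for N
    unfolding c_def by (rule sum_divisors_nonneg[where x = x, OF mult x1 vals]) (use that in simp)
  \<comment> \<open>Ensures that the powers of \<open>q\<close> are distinct; modulo 1 only the
    principal character exists.\<close>
  have "q \<noteq> 1"
  proof
    assume "q = 1"
    then have "\<psi> n = 1" for n
      using dcharactersD(1)[OF \<psi>(1)] dcharactersD(3)[OF \<psi>(1), of n 1] by simp
    then have "\<psi> = principal_character q" by (auto simp: principal_character_def \<open>q = 1\<close>)
    then show False using \<psi>(2) by blast
  qed
  then have q: "q \<ge> 2" using \<open>q > 0\<close> by simp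
  have c_power: "c (q ^ j) = 1" for j
  proof -
    have "c (q ^ j) = (\<Sum>d\<in>{1}. x d)"
      unfolding c_def
    proof (rule sum.mono_neutral_right)
      show "\<forall>d\<in>{d. d dvd q ^ j} - {1}. x d = 0"
      proof
        fix d assume d: "d \<in> {d. d dvd q ^ j} - {1}"
        have "\<not> coprime d q"
        proof
          assume "coprime d q"
          then have "coprime d (q ^ j)" by simp
          then show False using d coprime_absorb_left[of d "q ^ j"] by simp
        qed
        then show "x d = 0" using dcharactersD(4)[OF \<psi>(1)] by (simp add: x_def)
      qed
    qed (use q in auto)
    then show ?thesis using x1 by simp
  qed
  \<comment> \<open>With t^(q^J) = 1/2, each of the \<open>J\<close> terms t^(q^j), j < J, is at
    least 1/2; their sum is at least J / 2 = 2 q + 1/2, just beyond the bound 2 q.\<close>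
  define J where "J = 4 * q + 1"
  define t where "t = root (q ^ J) (1 / 2)"
  have tJ: "t ^ (q ^ J) = 1 / 2" unfolding t_def using q by (simp add: real_root_pow_pos2)
  have t0: "0 < t" unfolding t_def using q by simp
  have t1: "t < 1"
  proof (rule ccontr)
    assume "\<not> t < 1"
    then have "1 \<le> t ^ (q ^ J)" by (intro one_le_power) simp
    then show False using tJ by linarith
  qed
  obtain S where S: "((\<lambda>(n, k). \<psi> n * complex_of_real (t ^ (n * k))) has_sum S) ({1..} \<times> {1..})"
      "(\<lambda>n. \<psi> n * of_real (t ^ n / (1 - t ^ n))) sums S"
    using lambert_has_sum[where f = \<psi>, OF dcharacters_norm_le[OF \<psi>(1) \<open>q > 0\<close>] t0 t1] by blast
  have "((\<lambda>N. \<Sum>d | d dvd N. \<psi> d * complex_of_real (t ^ (d * (N div d)))) has_sum S) {1..}"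
    using has_sum_divisors[OF S(1)] by simp
  also have "?this \<longleftrightarrow> ((\<lambda>N. of_real (c N * t ^ N)) has_sum S) {1..}"
    by (intro has_sum_cong) (simp add: c_def x sum_distrib_right)
  finally have "((\<lambda>N. Re (of_real (c N * t ^ N))) has_sum Re S) {1..}" by (rule has_sum_Re)
  then have cS: "((\<lambda>N. c N * t ^ N) has_sum Re S) {1..}" by simp
  have inj: "inj_on (\<lambda>j. q ^ j) {..<J}" using q by (auto simp: inj_on_def power_inject_exp)
  have "real J / 2 = (\<Sum>j<J. t ^ (q ^ J))" by (simp add: tJ)
  also have "\<dots> \<le> (\<Sum>j<J. t ^ (q ^ j))"
    using t0 t1 q by (intro sum_mono power_decreasing power_increasing) auto
  also have "\<dots> = (\<Sum>N\<in>(\<lambda>j. q ^ j) ` {..<J}. c N * t ^ N)"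
    by (subst sum.reindex[OF inj]) (simp add: c_power)
  also have "\<dots> \<le> Re S"
    by (rule finite_sum_le_has_sum[OF cS]) (use q c_nonneg t0 in auto)
  also have "\<dots> \<le> norm S" by (rule complex_Re_le_cmod)
  also have "\<dots> \<le> 2 * real q" by (rule lambert_norm_le[OF assms(1-3) zero t0 t1 S(2)])
  finally show False by (simp add: J_def)
qed


section \<open>Divergence of the principal part near s = 1\<close>

text \<open>Write F = D / L: D is bounded, and on an interval of length l / (2 C) the Lipschitz
  bound keeps the norm of L above half its nonzero value at 1.\<close>

lemma Fser_bounded_near_1:
  assumes \<psi>: "\<psi> \<in> dcharacters q" "\<psi> \<noteq> principal_character q" and "q > 0"
  shows "\<exists>K. \<forall>\<^sub>F s in at_right 1. norm (Fser \<psi> s) \<le> K"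
proof -
  define C where "C = 2 + 2 * real q"
  define l where "l = norm (Lser \<psi> 1)"
  have "C > 0" by (simp add: C_def)
  have "l > 0"
    using Lser_1_nonzero_real[OF assms] Lser_1_nonzero_complex[OF \<psi>(1) _ \<open>q > 0\<close>] by (auto simp: l_def)
  have "norm (Fser \<psi> s) \<le> C / (l / 2)" if s: "1 < s" "s < 1 + l / (2 * C)" for s
  proof -
    have "norm (Lser \<psi> s - Lser \<psi> 1) \<le> C * (s - 1)"
      using norm_Lser_diff_1_le[OF assms, of s] s(1) by (simp add: C_def)
    also have "\<dots> \<le> C * (l / (2 * C))" using s \<open>C > 0\<close> by (intro mult_left_mono) auto
    also have "\<dots> = l / 2" using \<open>C > 0\<close> by simp
    finally have L: "norm (Lser \<psi> s) \<ge> l / 2"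
      using norm_triangle_ineq2[of "Lser \<psi> 1" "Lser \<psi> s"] unfolding l_def by (simp add: norm_minus_commute)
    then have "Lser \<psi> s \<noteq> 0" using \<open>l > 0\<close> by auto
    then have "Fser \<psi> s = Dser \<psi> s / Lser \<psi> s"
      using Lser_mult_Fser[OF \<psi>(1) \<open>q > 0\<close> s(1)] by (simp add: field_simps)
    moreover have "norm (Dser \<psi> s) \<le> C" unfolding C_def
      using norm_Dser_le[OF dcharacters_norm_le[OF \<psi>(1) \<open>q > 0\<close>] norm_sum_dcharacter_le[OF assms], of s] s(1) by simp
    ultimately show ?thesis using L \<open>l > 0\<close> \<open>C > 0\<close> by (simp only: norm_divide, intro frac_le) auto
  qed
  moreover have "1 + l / (2 * C) > 1" using \<open>l > 0\<close> \<open>C > 0\<close> by simp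
  ultimately show ?thesis unfolding eventually_at_right_field by blast
qed

text \<open>The terms n = 1 (mod q) alone suffice to show that L is unbounded at 1, without
  computing its residue.\<close>

lemma norm_Lser_principal_ge:
  assumes "q > 0" "s > 1"
  shows "(\<Sum>i<N. real (q * i + 1) powr - s) \<le> norm (Lser (principal_character q) s)"
proof -
  let ?f = "principal_character q"
  have f: "norm (?f n) \<le> 1" for n by (rule dcharacters_norm_le[OF principal_character_in \<open>q > 0\<close>])
  have "(\<lambda>n. ?f n * of_real (real n powr - s)) sums Lser ?f s"
    unfolding Lser_def
    by (rule summable_norm_cancel[THEN summable_sums, OF summable_norm_Lser[where f = ?f, OF f \<open>s > 1\<close>]])
  then have sm: "(\<lambda>n. Re (?f n * of_real (real n powr - s))) sums Re (Lser ?f s)" by (rule sums_Re)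
  have inj: "inj_on (\<lambda>i. q * i + 1) {..<N}" using \<open>q > 0\<close> by (auto simp: inj_on_def)
  have "coprime (q * i + 1) q" for i
    by (metis add.commute coprime_1_left gcd_add_mult coprime_iff_gcd_eq_1 gcd.commute mult.commute)
  then have "(\<Sum>i<N. real (q * i + 1) powr - s) =
      (\<Sum>n\<in>(\<lambda>i. q * i + 1) ` {..<N}. Re (?f n * of_real (real n powr - s)))"
    by (subst sum.reindex[OF inj]) (simp add: principal_character_def)
  also have "\<dots> \<le> (\<Sum>n. Re (?f n * of_real (real n powr - s)))"
    by (rule sum_le_suminf[OF sums_summable[OF sm]]) (auto simp: principal_character_def)
  also have "\<dots> = Re (Lser ?f s)" using sums_unique[OF sm] by simp
  also have "\<dots> \<le> norm (Lser ?f s)" by (rule complex_Re_le_cmod)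
  finally show ?thesis .
qed

lemma Fser_principal_unbounded_near_1:
  assumes "q > 0"
  shows "\<not> (\<forall>\<^sub>F s in at_right 1. norm (Fser (principal_character q) s) \<le> K)"
proof
  let ?f = "principal_character q"
  assume "\<forall>\<^sub>F s in at_right 1. norm (Fser ?f s) \<le> K"
  then obtain b where b: "b > 1" "\<And>s. 1 < s \<Longrightarrow> s < b \<Longrightarrow> norm (Fser ?f s) \<le> K"
    unfolding eventually_at_right_field by blast
  define s1 where "s1 = (1 + b) / 2"
  have s1: "1 < s1" "s1 < b" using b(1) by (auto simp: s1_def)
  have "K \<ge> 0" using b(2)[OF s1] norm_ge_zero order_trans by blast
  let ?u = "\<lambda>s. (norm (Lser ?f s))\<^sup>2"
  define M where "M = ?u s1 * exp (2 * K * s1)"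
  have u_le: "?u s \<le> M" if "1 < s" "s \<le> s1" for s
  proof -
    \<comment> \<open>If Re F <= K, the derivative 2 (K - Re F) u exp(2 K x) is nonnegative. Hence u
      = |L|^2 stays bounded down to 1, which the harmonic series will contradict.\<close>
    have "?u s * exp (2 * K * s) \<le> ?u s1 * exp (2 * K * s1)"
    proof (rule DERIV_nonneg_imp_nondecreasing[OF that(2)])
      fix x assume "s \<le> x" "x \<le> s1"
      then have x: "1 < x" "x < b" using that s1 by auto
      have e: "((\<lambda>x. exp (2 * K * x)) has_real_derivative exp (2 * K * x) * (2 * K)) (at x)"
        by (auto intro!: derivative_eq_intros)
      have "((\<lambda>x. ?u x * exp (2 * K * x)) has_real_derivative
          - 2 * Re (Fser ?f x) * ?u x * exp (2 * K * x) + exp (2 * K * x) * (2 * K) * ?u x) (at x)"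
        by (rule DERIV_mult[OF DERIV_norm_Lser_sq[OF principal_character_in \<open>q > 0\<close> x(1)] e])
      moreover have "Re (Fser ?f x) \<le> K" using b(2)[OF x] complex_Re_le_cmod order_trans by blast
      then have "0 \<le> 2 * (K - Re (Fser ?f x)) * ?u x * exp (2 * K * x)" by simp
      then have "0 \<le> - 2 * Re (Fser ?f x) * ?u x * exp (2 * K * x) + exp (2 * K * x) * (2 * K) * ?u x"
        by (simp add: algebra_simps)
      ultimately show "\<exists>y. ((\<lambda>x. ?u x * exp (2 * K * x)) has_real_derivative y) (at x) \<and> 0 \<le> y" by blast
    qed
    moreover have "?u s * 1 \<le> ?u s * exp (2 * K * s)"
      using \<open>K \<ge> 0\<close> that by (intro mult_left_mono) auto
    ultimately show ?thesis by (simp add: M_def)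
  qed
  have bound: "(\<Sum>i<N. 1 / real (q * i + 1)) \<le> sqrt M" for N
  proof -
    have lim: "((\<lambda>s. \<Sum>i<N. real (q * i + 1) powr - s) \<longlongrightarrow> (\<Sum>i<N. real (q * i + 1) powr - 1)) (at_right 1)"
      by (intro tendsto_intros) (simp del: of_nat_add of_nat_mult)
    have "\<forall>\<^sub>F s in at_right 1. (\<Sum>i<N. real (q * i + 1) powr - s) \<le> sqrt M"
      unfolding eventually_at_right_field
    proof (intro exI[of _ s1] conjI s1(1) allI impI)
      fix s assume s: "1 < s" "s < s1"
      have "norm (Lser ?f s) \<le> sqrt M" using u_le[of s] s by (intro real_le_rsqrt) simp
      then show "(\<Sum>i<N. real (q * i + 1) powr - s) \<le> sqrt M"
        using norm_Lser_principal_ge[OF \<open>q > 0\<close> s(1), of N] by simp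
    qed
    from tendsto_upperbound[OF lim this] show ?thesis by (simp add: powr_minus divide_inverse)
  qed
  have "summable (\<lambda>i. 1 / real (q * i + 1))"
    by (rule summableI_nonneg_bounded[where x = "sqrt M"]) (use bound in auto)
  then have "summable (\<lambda>i. real q * (1 / real (q * i + 1)))" by (rule summable_mult)
  then have "summable (\<lambda>i. 1 / real (Suc i))"
  proof (rule summable_comparison_test'[where N = 0])
    fix i :: nat
    have "real (q * i + 1) \<le> real q * real (Suc i)" using \<open>q > 0\<close> by (simp add: algebra_simps)
    then show "norm (1 / real (Suc i)) \<le> real q * (1 / real (q * i + 1))"
      by (simp add: divide_simps del: of_nat_Suc of_nat_add of_nat_mult)
  qed
  then show False using not_summable_harmonic[where 'a = real] 
      summable_Suc_iff[of "\<lambda>n. inverse (real n)"] by (simp add: divide_inverse)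
qed

text \<open>For p^k with k >= 2 put r = p^(k div 2): then p^k is r^2 or r^2 p, and lies between r^2
  and r^3. Its weight is therefore at most 3 ln r / r^2.\<close>

lemma summable_on_mangoldt_nonprime:
  "(\<lambda>n. mangoldt n / real n) summable_on {n. primepow n \<and> \<not> prime n}"
proof -
  let ?w = "\<lambda>n. mangoldt n / real n"
  let ?v = "\<lambda>r. 3 * (ln (real r) * real r powr - 2)"
  have v: "?v summable_on A" for A
  proof -
    have "?v summable_on UNIV"
      by (rule summable_nonneg_imp_summable_on) (auto intro!: summable_mult summable_ln_powr ln_nat_nonneg mult_nonneg_nonneg)
    then show ?thesis by (rule summable_on_subset_banach) auto
  qed
  have main: "?w summable_on S" if g: "\<And>r. r \<ge> 2 \<Longrightarrow> r\<^sup>2 \<le> g r \<and> g r \<le> r ^ 3" and S: "S \<subseteq> g ` {2..}" for S g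
  proof -
    \<comment> \<open>\<open>U\<close> picks one preimage for every element of \<open>S\<close>,
      which turns \<open>g\<close> into an injective parametrisation.\<close>
    obtain U where U: "U \<subseteq> {2..}" "inj_on g U" "S = g ` U" using S unfolding subset_image_inj by blast
    have "(?w \<circ> g) summable_on U"
    proof (rule summable_on_comparison_test[OF v])
      fix r assume "r \<in> U"
      then have r: "r \<ge> 2" using U by auto
      have le: "r\<^sup>2 \<le> g r" "g r \<le> r ^ 3" using g[OF r] by auto
      have "0 < r\<^sup>2" using r by simp
      then have pos: "0 < r\<^sup>2" "0 < g r" using le by linarith+
      have "mangoldt (g r) \<le> ln (real (g r))" using le pos by (intro mangoldt_le) linarith
      also have "\<dots> \<le> ln (real (r ^ 3))" using le pos by (intro ln_mono) auto
      also have "\<dots> = 3 * ln (real r)" using r by (simp add: ln_realpow)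
      finally have "?w (g r) \<le> 3 * ln (real r) / real (r\<^sup>2)"
        using le pos r by (intro frac_le) (auto simp: ln_nat_nonneg simp flip: of_nat_power)
      then show "(?w \<circ> g) r \<le> ?v r" using r by (simp add: powr_minus powr_numeral divide_inverse)
      show "0 \<le> (?w \<circ> g) r" by (simp add: mangoldt_nonneg)
    qed
    then show ?thesis unfolding U(3) by (subst summable_on_reindex[OF U(2)])
  qed
  have a: "aprimedivisor r dvd r" "aprimedivisor r > 0" if "r \<ge> 2" for r :: nat
    using that aprimedivisor_dvd'[of r] by (auto intro!: aprimedivisor_dvd aprimedivisor_pos_nat)
  let ?S0 = "{n. primepow n \<and> \<not> prime n} \<inter> (\<lambda>r::nat. r\<^sup>2) ` {2..}"
  let ?S1 = "{n. primepow n \<and> \<not> prime n} \<inter> (\<lambda>r::nat. r\<^sup>2 * aprimedivisor r) ` {2..}"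
  have "?w summable_on ?S0"
    by (rule main[of "\<lambda>r. r\<^sup>2"]) (auto intro: power_increasing)
  moreover have "?w summable_on ?S1"
  proof (rule main[of "\<lambda>r. r\<^sup>2 * aprimedivisor r"])
    fix r :: nat assume r: "r \<ge> 2"
    then have "aprimedivisor r \<le> r" using a[OF r] by (intro dvd_imp_le) auto
    then show "r\<^sup>2 \<le> r\<^sup>2 * aprimedivisor r \<and> r\<^sup>2 * aprimedivisor r \<le> r ^ 3"
      using a[OF r] by (auto simp: power3_eq_cube power2_eq_square)
  qed auto
  moreover have "{n. primepow n \<and> \<not> prime n} \<subseteq> ?S0 \<union> ?S1"
  proof
    fix n :: nat assume n: "n \<in> {n. primepow n \<and> \<not> prime n}"
    then obtain p k where p: "prime p" "k > 0" "n = p ^ k" by (auto simp: primepow_def)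
    then have "k \<noteq> 1" using n by auto
    define j where "j = k div 2"
    have j: "j > 0" using p(2) \<open>k \<noteq> 1\<close> by (simp add: j_def)
    then have "1 < p ^ j" using prime_gt_1_nat[OF p(1)] one_less_power by blast
    then have pj: "p ^ j \<in> {2..}" by simp
    show "n \<in> ?S0 \<union> ?S1"
    proof (cases "even k")
      case True
      then have "n = (p ^ j)\<^sup>2" using p(3) by (simp add: j_def flip: power_mult)
      then show ?thesis using n pj by blast
    next
      case False
      then have "k = j * 2 + 1" unfolding j_def by presburger
      then have "n = (p ^ j)\<^sup>2 * p" using p(3) by (simp add: power_mult)
      moreover have "aprimedivisor (p ^ j) = p" using aprimedivisor_prime_power[OF p(1) j] .
      ultimately have "n = (\<lambda>r. r\<^sup>2 * aprimedivisor r) (p ^ j)" by simp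
      then show ?thesis using n pj by blast
    qed
  qed
  ultimately show ?thesis using summable_on_union summable_on_subset_banach by blast
qed


text \<open>With finitely many primes in the class, \<open>Gser\<close> would stay bounded as s
  tends to 1: the higher prime powers contribute a convergent sum. Orthogonality expresses F of the
  principal character through \<open>Gser\<close> and the bounded F of the others, so it would be
  bounded too.\<close>

theorem infinite_primes_cong:
  assumes "coprime a q" "q > 0"
  shows "infinite {p :: nat. prime p \<and> [p = a] (mod q)}"
proof
  let ?A = "{p :: nat. prime p \<and> [p = a] (mod q)}"
  assume fin: "finite ?A"
  obtain c where c: "[a * c = 1] (mod q)" using cong_solve_coprime_nat[OF assms(1)] by auto
  then have "coprime (a * c) q" using cong_imp_coprime[OF cong_sym[OF c]] by simp
  then have "coprime c q" by simp
  have cn: "[n = a] (mod q)" if "[c * n = 1] (mod q)" for n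
  proof -
    have "[c * n = c * a] (mod q)" using that c by (metis cong_sym cong_trans mult.commute)
    then show ?thesis using cong_mult_lcancel_nat[OF \<open>coprime c q\<close>] by blast
  qed
  let ?w = "\<lambda>n. mangoldt n / real n"
  let ?N = "{n. primepow n \<and> \<not> prime n}"
  define B where "B = (\<Sum>p\<in>?A. ?w p) + infsum ?w ?N"
  have G: "Gser q c s \<le> B" if "s > 1" for s
    unfolding Gser_def
  proof (rule suminf_le_const[OF summable_Gser[OF that]])
    fix N
    let ?t = "\<lambda>n. if [c * n = 1] (mod q) then mangoldt n * real n powr - s else (0::real)"
    have t: "?t n \<le> ?w n" for n
    proof (cases "n = 0")
      case False
      then have "real n powr - s \<le> real n powr - 1" using that by (intro powr_mono) auto
      then have "mangoldt n * real n powr - s \<le> ?w n"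
        using False mult_left_mono[OF _ mangoldt_nonneg[of n]] by (fastforce simp: powr_minus divide_inverse)
      then show ?thesis using mangoldt_nonneg[of n] by auto
    qed simp
    have "(\<Sum>n<N. ?t n) = (\<Sum>n\<in>{..<N} \<inter> (?A \<union> ?N). ?t n)"
      using cn by (intro sum.mono_neutral_right) (auto simp: mangoldt_def)
    also have "\<dots> \<le> (\<Sum>n\<in>{..<N} \<inter> (?A \<union> ?N). ?w n)" by (intro sum_mono t)
    also have "\<dots> = (\<Sum>n\<in>{..<N} \<inter> ?A. ?w n) + (\<Sum>n\<in>{..<N} \<inter> ?N. ?w n)"
      unfolding Int_Un_distrib by (rule sum.union_disjoint) auto
    also have "\<dots> \<le> (\<Sum>n\<in>?A. ?w n) + infsum ?w ?N"
      by (intro add_mono sum_mono2 fin finite_sum_le_infsum summable_on_mangoldt_nonprime)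
        (auto simp: mangoldt_nonneg simp del: mangoldt_prime)
    finally show "(\<Sum>n<N. ?t n) \<le> B" unfolding B_def .
  qed
  let ?C = "dcharacters q" and ?f = "principal_character q"
  have "\<exists>K. \<forall>\<psi>\<in>?C - {?f}. \<forall>\<^sub>F s in at_right 1. norm (Fser \<psi> s) \<le> K \<psi>"
    using Fser_bounded_near_1[OF _ _ \<open>q > 0\<close>] by (intro bchoice ballI) auto
  then obtain K where "\<forall>\<psi>\<in>?C - {?f}. \<forall>\<^sub>F s in at_right 1. norm (Fser \<psi> s) \<le> K \<psi>" by blast
  then have "\<forall>\<^sub>F s in at_right 1. \<forall>\<psi>\<in>?C - {?f}. norm (Fser \<psi> s) \<le> K \<psi>"
    using finite_dcharacters[OF \<open>q > 0\<close>] by (intro eventually_ball_finite) auto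
  moreover have "\<forall>\<^sub>F s in at_right (1::real). s > 1" by (simp add: eventually_at_right_less)
  ultimately have "\<forall>\<^sub>F s in at_right 1. norm (Fser ?f s) \<le> real (card ?C) * B + (\<Sum>\<psi>\<in>?C - {?f}. K \<psi>)"
  proof eventually_elim
    case (elim s)
    have fc: "?f c = 1" using \<open>coprime c q\<close> by (simp add: principal_character_def)
    have "of_real (real (card ?C) * Gser q c s) = ?f c * Fser ?f s + (\<Sum>\<psi>\<in>?C - {?f}. \<psi> c * Fser \<psi> s)"
      unfolding sum_dcharacters_Fser[OF \<open>q > 0\<close> elim(2), symmetric]
      by (rule sum.remove[OF finite_dcharacters[OF \<open>q > 0\<close>] principal_character_in])
    then have "Fser ?f s = of_real (real (card ?C) * Gser q c s) - (\<Sum>\<psi>\<in>?C - {?f}. \<psi> c * Fser \<psi> s)"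
      by (simp add: fc)
    also have "norm \<dots> \<le> norm (complex_of_real (real (card ?C) * Gser q c s)) + norm (\<Sum>\<psi>\<in>?C - {?f}. \<psi> c * Fser \<psi> s)"
      by (rule norm_triangle_ineq4)
    also have "\<dots> \<le> real (card ?C) * B + (\<Sum>\<psi>\<in>?C - {?f}. K \<psi>)"
    proof (rule add_mono)
      show "norm (complex_of_real (real (card ?C) * Gser q c s)) \<le> real (card ?C) * B"
        using Gser_nonneg[OF elim(2)] G[OF elim(2)] unfolding norm_of_real by (simp add: mult_left_mono)
      show "norm (\<Sum>\<psi>\<in>?C - {?f}. \<psi> c * Fser \<psi> s) \<le> (\<Sum>\<psi>\<in>?C - {?f}. K \<psi>)"
      proof (rule sum_norm_le)
        fix \<psi> assume \<psi>: "\<psi> \<in> ?C - {?f}"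
        have "norm (\<psi> c * Fser \<psi> s) \<le> 1 * norm (Fser \<psi> s)"
          unfolding norm_mult using dcharacters_norm_le[of \<psi> q c] \<psi> \<open>q > 0\<close> by (intro mult_right_mono) auto
        also have "\<dots> \<le> K \<psi>" using bspec[OF elim(1) \<psi>] by simp
        finally show "norm (\<psi> c * Fser \<psi> s) \<le> K \<psi>" .
      qed
    qed
    finally show ?case .
  qed
  then show False using Fser_principal_unbounded_near_1[OF \<open>q > 0\<close>] by blast
qed

section \<open>Greedy orderings of the primes\<close>

lemma exists_prime_cong_int:
  fixes x :: int
  assumes "coprime x (int n)" "n > 0"
  shows "\<exists>p. prime p \<and> int n dvd (p - x)"
proof -
  have "coprime (x mod int n) (int n)" using assms by simp
  then have "coprime (nat (x mod int n)) n"
    using assms(2) by (metis coprime_int_iff int_nat_eq of_nat_0_less_iff pos_mod_sign)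
  then have "infinite {p. prime p \<and> [p = nat (x mod int n)] (mod n)}"
    by (rule infinite_primes_cong[OF _ assms(2)])
  then obtain p where p: "prime p" "[p = nat (x mod int n)] (mod n)"
    using not_finite_existsD by blast
  then have "[int p = x] (mod int n)"
    using assms(2) by (metis cong_int_iff cong_mod_right cong_refl int_nat_eq of_nat_0_less_iff pos_mod_sign cong_trans)
  then show ?thesis using p(1) by (intro exI[of _ "int p"]) (auto simp: cong_iff_dvd_diff)
qed

section \<open>Exponents as sums of residue counts\<close>

text \<open>The exponents k with b^k dividing x form an initial segment, so the order counts the
  levels m >= 1 that divide. Truncation at \<open>M\<close> is always a lower bound, also where the
  order is infinite.\<close>

lemma ord_b_bounds:
  assumes "b \<ge> 2"
  shows "enat (\<Sum>m=1..M. of_bool (int b ^ m dvd x)) \<le> ord_b b x"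
    and "\<not> int b ^ Suc M dvd x \<Longrightarrow> ord_b b x = enat (\<Sum>m=1..M. of_bool (int b ^ m dvd x))"
proof -
  have *: "enat (\<Sum>m=1..M. of_bool (int b ^ m dvd x)) \<le> ord_b b x \<and>
    (\<not> int b ^ Suc M dvd x \<longrightarrow> ord_b b x = enat (\<Sum>m=1..M. of_bool (int b ^ m dvd x)))" if "x \<noteq> 0"
  proof -
    let ?K = "{k. int b ^ k dvd x}"
    \<comment> \<open>From k < b^k <= |x|; finiteness of the set makes \<open>Max\<close> in
      \<open>ord_b\<close> the true maximum.\<close>
    have "k < nat \<bar>x\<bar>" if "k \<in> ?K" for k
    proof -
      have "int b ^ k \<le> \<bar>x\<bar>" using that \<open>x \<noteq> 0\<close> dvd_imp_le_int[of x "int b ^ k"] by simp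
      moreover have "k < b ^ k" using assms by (intro power_gt_expt) simp
      then have "int k < int b ^ k" by (metis of_nat_less_iff of_nat_power)
      ultimately show ?thesis by linarith
    qed
    then have fin: "finite ?K" by (auto intro: finite_subset[of _ "{..<nat \<bar>x\<bar>}"])
    define v where "v = Max ?K"
    have v: "v \<in> ?K" unfolding v_def by (rule Max_in[OF fin]) (auto intro: exI[of _ 0])
    have iff: "int b ^ k dvd x \<longleftrightarrow> k \<le> v" for k
      using v Max_ge[OF fin, of k] by (auto simp: v_def[symmetric] intro: power_le_dvd)
    have "(\<Sum>m=1..M. of_bool (int b ^ m dvd x)) = (\<Sum>m=1..M. of_bool (m \<le> v) :: nat)" by (simp add: iff)
    also have "\<dots> = card {m \<in> {1..M}. m \<le> v}" by (simp add: of_bool_def sum.If_cases Int_def)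
    also have "{m \<in> {1..M}. m \<le> v} = {1..min M v}" by auto
    finally have "(\<Sum>m=1..M. of_bool (int b ^ m dvd x)) = min M v" by simp
    moreover have "ord_b b x = enat v" using that by (simp add: ord_b_def v_def)
    ultimately show ?thesis using iff[of "Suc M"] by auto
  qed
  show "enat (\<Sum>m=1..M. of_bool (int b ^ m dvd x)) \<le> ord_b b x"
    using * by (cases "x = 0") (auto simp: ord_b_def)
  show "ord_b b x = enat (\<Sum>m=1..M. of_bool (int b ^ m dvd x))" if "\<not> int b ^ Suc M dvd x"
    using * that by (cases "x = 0") auto
qed

definition residue_count :: "nat \<Rightarrow> (nat \<Rightarrow> int) \<Rightarrow> nat \<Rightarrow> nat \<Rightarrow> int \<Rightarrow> nat" where
  "residue_count b a m k x = (\<Sum>j<k. of_bool (int b ^ m dvd x - a j))"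

lemma residue_count_cong:
  assumes "int b ^ m dvd x - y"
  shows "residue_count b a m k x = residue_count b a m k y"
proof -
  have "int b ^ m dvd x - a j \<longleftrightarrow> int b ^ m dvd y - a j" for j
    using dvd_add_right_iff[OF assms, of "y - a j"] by simp
  then show ?thesis by (simp add: residue_count_def)
qed

text \<open>Interchanging the sums over earlier entries and over levels turns the cost into one
  congruence count per level. An empty class at level \<open>Suc M\<close> makes the truncation
  exact.\<close>

lemma ord_sum_bounds:
  assumes "b \<ge> 2"
  shows "enat (\<Sum>m=1..M. residue_count b a m k x) \<le> ord_sum b a k x"
    and "residue_count b a (Suc M) k x = 0 \<Longrightarrow> ord_sum b a k x = enat (\<Sum>m=1..M. residue_count b a m k x)"
proof -
  have enat_sum: "(\<Sum>j<k. enat (f j)) = enat (\<Sum>j<k. f j)" for f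
    by (induction k) (auto simp: zero_enat_def)
  have eq: "(\<Sum>m=1..M. residue_count b a m k x) = (\<Sum>j<k. \<Sum>m=1..M. of_bool (int b ^ m dvd x - a j))"
    unfolding residue_count_def by (rule sum.swap)
  show "enat (\<Sum>m=1..M. residue_count b a m k x) \<le> ord_sum b a k x"
    unfolding eq enat_sum[symmetric] ord_sum_def by (intro sum_mono ord_b_bounds assms)
  assume "residue_count b a (Suc M) k x = 0"
  then have "\<not> int b ^ Suc M dvd x - a j" if "j < k" for j
    using that by (auto simp: residue_count_def)
  then show "ord_sum b a k x = enat (\<Sum>m=1..M. residue_count b a m k x)"
    unfolding eq enat_sum[symmetric] ord_sum_def by (intro sum.cong ord_b_bounds assms) auto
qed

definition unit_count :: "nat \<Rightarrow> (nat \<Rightarrow> int) \<Rightarrow> nat \<Rightarrow> nat" where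
  "unit_count b a k = (\<Sum>j<k. of_bool (coprime (a j) (int b)))"

lemma unit_count_le: "unit_count b a k \<le> k"
  unfolding unit_count_def using sum_bounded_above[of "{..<k}" "\<lambda>j. of_bool (coprime (a j) (int b)) :: nat" 1] by simp

lemma sum_of_bool_eq_1: "finite A \<Longrightarrow> z \<in> A \<Longrightarrow> (\<And>t. t \<in> A \<Longrightarrow> P t \<longleftrightarrow> t = z) \<Longrightarrow> (\<Sum>t\<in>A. of_bool (P t)) = (1::nat)"
  by (subst sum.remove[of A z]) (auto intro: sum.neutral)

lemma coprime_cong_power:
  assumes "int b ^ m dvd x - y" "m \<ge> 1" "coprime y (int b)"
  shows "coprime x (int b)"
proof -
  have "int b dvd x - y" using assms(1,2) dvd_power[of m "int b"] dvd_trans by (metis less_eq_Suc_le One_nat_def)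
  then have "[y = x] (mod int b)" by (metis cong_iff_dvd_diff cong_sym)
  then show ?thesis using cong_imp_coprime assms(3) by blast
qed

text \<open>Each unit lies in exactly one class represented by a totative of b^m, each non-unit in
  none.\<close>

lemma sum_residue_count_totatives:
  assumes "b \<ge> 2" "m \<ge> 1"
  shows "(\<Sum>r\<in>totatives (b ^ m). residue_count b a m k (int r)) = unit_count b a k"
proof -
  have bm: "b ^ m > 1" using assms by (intro one_less_power) auto
  have "(\<Sum>r\<in>totatives (b ^ m). of_bool (int b ^ m dvd int r - y)) = (of_bool (coprime y (int b)) :: nat)" for y
  proof (cases "coprime y (int b)")
    case True
    define r where "r = nat (y mod int (b ^ m))"
    have "0 \<le> y mod int (b ^ m)" using assms(1) by (intro pos_mod_sign) simp
    then have r: "int r = y mod int (b ^ m)" unfolding r_def by simp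
    have "int b ^ m dvd int r - y" unfolding r by (simp add: mod_eq_dvd_iff[symmetric])
    then have "coprime (int r) (int b)" using coprime_cong_power assms(2) True by blast
    then have cop: "coprime r (b ^ m)" by simp
    have "int r < int (b ^ m)" unfolding r using assms(1) by (intro pos_mod_bound) simp
    then have lt: "r < b ^ m" by simp
    have "r \<noteq> 0" using cop assms by (intro notI) auto
    then have "r \<in> totatives (b ^ m)" using cop lt by (simp add: totatives_def)
    moreover have "int b ^ m dvd int t - y \<longleftrightarrow> t = r" if "t \<in> totatives (b ^ m)" for t
    proof -
      have "t < b ^ m" using that bm totatives_less by blast
      then have "int t mod int (b ^ m) = int t" by simp
      then show ?thesis unfolding of_nat_power[symmetric] mod_eq_dvd_iff[symmetric] r[symmetric] by simp
    qed
    ultimately show ?thesis using True by (simp add: sum_of_bool_eq_1)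
  next
    case False
    have "\<not> int b ^ m dvd int r - y" if "r \<in> totatives (b ^ m)" for r
    proof
      assume "int b ^ m dvd int r - y"
      then have "int b ^ m dvd y - int r" by (simp add: dvd_diff_commute)
      moreover have "coprime (int r) (int b)" using that assms(2) by (simp add: totatives_def)
      ultimately show False using coprime_cong_power assms(2) False by blast
    qed
    then show ?thesis using False by simp
  qed
  then show ?thesis
    unfolding residue_count_def unit_count_def by (subst sum.swap) simp
qed

section \<open>A unit class that is cheap at all levels\<close>

lemma exists_le_average:
  fixes f :: "'a \<Rightarrow> nat"
  assumes "finite A" "A \<noteq> {}"
  shows "\<exists>x\<in>A. f x \<le> (\<Sum>x\<in>A. f x) div card A"
proof (rule ccontr)
  assume "\<not> ?thesis"
  then have "Suc ((\<Sum>x\<in>A. f x) div card A) \<le> f x" if "x \<in> A" for x using that by (auto simp: not_le)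
  then have "card A * Suc ((\<Sum>x\<in>A. f x) div card A) \<le> (\<Sum>x\<in>A. f x)"
    using sum_bounded_below[of A "Suc ((\<Sum>x\<in>A. f x) div card A)" f] by simp
  moreover have "card A > 0" using assms by (simp add: card_gt_0_iff)
  ultimately show False
    using dividend_less_times_div[of "card A" "\<Sum>x\<in>A. f x"] by simp
qed

lemma totient_power_pos: "b \<ge> 2 \<Longrightarrow> totient (b ^ m) > 0"
  by simp

text \<open>Induction on the level. Averaging over unit classes settles modulus \<open>b\<close>;
  afterwards averaging over the \<open>b\<close> lifts of the current class adds one level without
  disturbing lower ones. Nested floors combine because phi(b^M) b = phi(b^(M+1)) for M >= 1.\<close>

lemma exists_residue_le:
  assumes "b \<ge> 2" "M \<ge> 1"
  shows "\<exists>x. coprime x (int b) \<and> (\<forall>m\<in>{1..M}. residue_count b a m k x \<le> unit_count b a k div totient (b ^ m))"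
  using assms(2)
proof (induction M rule: dec_induct)
  case base
  have "totatives (b ^ 1) \<noteq> {}" using totient_power_pos[OF assms(1), of 1] assms(1) by (auto simp: totient_def)
  from exists_le_average[OF _ this, of "\<lambda>r. residue_count b a 1 k (int r)"]
  obtain r where "r \<in> totatives (b ^ 1)" "residue_count b a 1 k (int r) \<le> unit_count b a k div totient (b ^ 1)"
    using sum_residue_count_totatives[OF assms(1), of 1 a k] assms(1) unfolding totient_def by auto
  then show ?case by (intro exI[of _ "int r"]) (auto simp: totatives_def)
next
  case (step M)
  then obtain x where x: "coprime x (int b)"
    "\<And>m. m \<in> {1..M} \<Longrightarrow> residue_count b a m k x \<le> unit_count b a k div totient (b ^ m)" by blast
  let ?y = "\<lambda>t. x + int t * int b ^ M"
  have "(\<Sum>t<b. of_bool (int b ^ Suc M dvd ?y t - z)) = (of_bool (int b ^ M dvd x - z) :: nat)" for z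
  proof (cases "int b ^ M dvd x - z")
    case True
    then obtain u where u: "x - z = int b ^ M * u" by blast
    \<comment> \<open>Writing x - z = b^M u, the lift with parameter t agrees with z one level
      higher iff b divides t + u, so exactly one lift does.\<close>
    define s where "s = nat ((- u) mod int b)"
    have s: "int s = (- u) mod int b" unfolding s_def using assms(1) by simp
    have "s < b" using pos_mod_bound[of "int b" "- u"] assms(1) unfolding s[symmetric] by simp
    have "int b ^ Suc M dvd ?y t - z \<longleftrightarrow> t = s" if "t < b" for t
    proof -
      have "?y t - z = int b ^ M * (int t + u)" using u by (simp add: algebra_simps)
      then have "int b ^ Suc M dvd ?y t - z \<longleftrightarrow> int b dvd int t - (- u)"
        using assms(1) by (simp add: mult.commute[of "int b"])
      also have "\<dots> \<longleftrightarrow> int t mod int b = int s" unfolding s by (rule mod_eq_dvd_iff[symmetric])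
      finally show ?thesis using that by simp
    qed
    then show ?thesis using True \<open>s < b\<close> by (subst sum_of_bool_eq_1[of _ s]) auto
  next
    case False
    have "\<not> int b ^ Suc M dvd ?y t - z" for t
    proof
      assume "int b ^ Suc M dvd ?y t - z"
      then have "int b ^ M dvd ?y t - z" by (rule power_le_dvd) simp
      then have "int b ^ M dvd (?y t - z) - int t * int b ^ M" by (rule dvd_diff) simp
      also have "(?y t - z) - int t * int b ^ M = x - z" by simp
      finally show False using False by blast
    qed
    then show ?thesis using False by simp
  qed
  then have "(\<Sum>t<b. residue_count b a (Suc M) k (?y t)) = residue_count b a M k x"
    unfolding residue_count_def by (subst sum.swap) simp
  moreover have "0 \<in> {..<b}" using assms(1) by simp
  then have "{..<b} \<noteq> {}" by blast
  ultimately obtain t where t: "residue_count b a (Suc M) k (?y t) \<le> residue_count b a M k x div b"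
    using exists_le_average[of "{..<b}" "\<lambda>t. residue_count b a (Suc M) k (?y t)"] by auto
  have "residue_count b a M k x div b \<le> unit_count b a k div totient (b ^ M) div b"
    using x(2)[of M] step by (intro div_le_mono) auto
  also have "\<dots> = unit_count b a k div (totient (b ^ M) * b)" by (rule div_mult2_eq[symmetric])
  also have "totient (b ^ M) * b = totient (b ^ Suc M)"
    unfolding totient_power_Suc using step(1) power_minus_mult[of M b] by (simp add: totient_power mult_ac)
  finally have new: "residue_count b a (Suc M) k (?y t) \<le> unit_count b a k div totient (b ^ Suc M)"
    using t by linarith
  have old: "residue_count b a m k (?y t) = residue_count b a m k x" if "m \<le> M" for m
    using that by (intro residue_count_cong) (auto intro: dvd_mult le_imp_power_dvd)
  have "coprime (?y t) (int b)"
    by (rule coprime_cong_power[of b M _ x]) (use step x(1) in auto)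
  then show ?case using new old x(2) by (intro exI[of _ "?y t"]) (auto simp: le_Suc_eq)
qed

definition level_sum :: "nat \<Rightarrow> nat \<Rightarrow> nat \<Rightarrow> nat" where
  "level_sum b c k = (\<Sum>m=1..k. c div totient (b ^ m))"

text \<open>c <= k < b^k <= b^(m-1) phi(b) = phi(b^m). Thus levels above k contribute nothing, which
  justifies cutting \<open>level_sum\<close> off at k.\<close>

lemma div_totient_power_eq_0:
  assumes "b \<ge> 2" "c \<le> k" "k < m"
  shows "c div totient (b ^ m) = 0"
proof -
  have "c < b ^ k" using power_gt_expt[of b k] assms by simp
  also have "\<dots> \<le> b ^ (m - 1)" using assms by (intro power_increasing) auto
  also have "\<dots> \<le> b ^ (m - 1) * totient b" using assms by (simp add: Suc_le_eq)
  finally show ?thesis using assms by (simp add: totient_power)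
qed

text \<open>Dirichlet's theorem is applied modulo b^(k+1), one level beyond those that count: the
  class there is empty, so the cost is finite and equals the truncated sum.\<close>

lemma exists_prime_ord_sum_le:
  assumes "b \<ge> 2"
  shows "\<exists>p. prime p \<and> ord_sum b a k p \<le> enat (level_sum b (unit_count b a k) k)"
proof -
  obtain x where x: "coprime x (int b)"
    "\<And>m. m \<in> {1..Suc k} \<Longrightarrow> residue_count b a m k x \<le> unit_count b a k div totient (b ^ m)"
    using exists_residue_le[OF assms, of "Suc k" a k] by auto
  have "coprime x (int (b ^ Suc k))" using x(1) by simp
  then obtain p where p: "prime p" "int (b ^ Suc k) dvd p - x"
    using exists_prime_cong_int[of x "b ^ Suc k"] assms by auto
  have count: "residue_count b a m k p \<le> unit_count b a k div totient (b ^ m)" if "m \<in> {1..Suc k}" for m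
  proof -
    have "int b ^ m dvd p - x" using p(2) that power_le_dvd[of "int b" "Suc k" "p - x" m] by simp
    then show ?thesis using residue_count_cong x(2)[OF that] by metis
  qed
  have "residue_count b a (Suc k) k p = 0"
    using count[of "Suc k"] div_totient_power_eq_0[OF assms unit_count_le, of k "Suc k"] by simp
  then have "ord_sum b a k p = enat (\<Sum>m=1..k. residue_count b a m k p)" by (rule ord_sum_bounds(2)[OF assms])
  also have "\<dots> \<le> enat (level_sum b (unit_count b a k) k)"
    unfolding level_sum_def using count by (auto intro!: sum_mono)
  finally show ?thesis using p(1) by blast
qed


section \<open>Balance of an arbitrary ordering\<close>

lemma ord_sum_le_level_sum:
  assumes "b \<ge> 2" "is_b_ordering b {p. prime p} a"
  shows "ord_sum b a k (a k) \<le> enat (level_sum b (unit_count b a k) k)"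
proof (cases "k \<ge> 1")
  case True
  obtain p where p: "prime p" "ord_sum b a k p \<le> enat (level_sum b (unit_count b a k) k)"
    using exists_prime_ord_sum_le[OF assms(1)] by blast
  have "ord_sum b a k (a k) \<le> ord_sum b a k p" using assms(2) True p(1) by (auto simp: is_b_ordering_def)
  then show ?thesis using p(2) by (rule order_trans)
next
  case False
  then have "k = 0" by simp
  then show ?thesis by (simp add: ord_sum_def)
qed

lemma sum_le_imp_pointwise_eq:
  fixes f g :: "'a \<Rightarrow> nat"
  assumes "finite A" "\<And>x. x \<in> A \<Longrightarrow> f x \<le> g x" "(\<Sum>x\<in>A. g x) \<le> (\<Sum>x\<in>A. f x)" "x \<in> A"
  shows "g x = f x"
proof (rule ccontr)
  assume "g x \<noteq> f x"
  then have "f x < g x" using assms(2)[OF assms(4)] by simp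
  then have "(\<Sum>x\<in>A. f x) < (\<Sum>x\<in>A. g x)" using assms by (intro sum_strict_mono_ex1) auto
  then show False using assms(3) by simp
qed

lemma residue_count_Suc_non_unit: "m \<ge> 1 \<Longrightarrow> coprime x (int b) \<Longrightarrow> \<not> coprime (a k) (int b) \<Longrightarrow>
    residue_count b a m (Suc k) x = residue_count b a m k x"
  using coprime_cong_power[of b m "a k" x] by (auto simp: residue_count_def dvd_diff_commute)

text \<open>A greedy choice keeps the unit classes balanced at every level: writing \<open>\<phi>\<close> for the number
  of unit classes modulo \<open>b ^ m\<close>, each of them holds \<open>\<lfloor>c / \<phi>\<rfloor>\<close> or \<open>\<lceil>c / \<phi>\<rceil>\<close> of the \<open>c\<close> units chosen so far.\<close>
lemma residue_count_balanced:
  assumes b: "b \<ge> 2" and a: "is_b_ordering b {p. prime p} a" and "m \<ge> 1" "coprime x (int b)"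
  shows "totient (b ^ m) * residue_count b a m k x < unit_count b a k + totient (b ^ m) \<and>
    unit_count b a k < totient (b ^ m) * residue_count b a m k x + totient (b ^ m)"
  using assms(3,4)
proof (induction k arbitrary: m x)
  case 0
  then show ?case using b by (simp add: residue_count_def unit_count_def)
next
  case (Suc k)
  let ?N = "residue_count b a" and ?c = "unit_count b a k" and ?\<phi> = "\<lambda>m. totient (b ^ m)"
  show ?case
  proof (cases "coprime (a k) (int b)")
    case False
    then have "unit_count b a (Suc k) = ?c" by (simp add: unit_count_def)
    moreover have "?N m (Suc k) x = ?N m k x"
      using residue_count_Suc_non_unit Suc.prems False by blast
    ultimately show ?thesis using Suc.IH[OF Suc.prems] by simp
  next
    case True
    have c: "unit_count b a (Suc k) = Suc ?c" using True by (simp add: unit_count_def)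
    have lower: "?c div ?\<phi> l \<le> ?N l k y" if "l \<ge> 1" "coprime y (int b)" for l y
    proof -
      have "?c < ?\<phi> l * Suc (?N l k y)" using Suc.IH[OF that] by simp
      then have "?c div ?\<phi> l < Suc (?N l k y)" using b by (simp add: less_mult_imp_div_less mult.commute)
      then show ?thesis by simp
    qed
    \<comment> \<open>Balance bounds the count at every level from below by the floor, while
      minimality bounds their sum by the sum of floors; hence equality level by level. Summing up to
      \<open>max k l\<close> makes sure that level \<open>l\<close> takes part.\<close>
    have greedy: "?N l k (a k) = ?c div ?\<phi> l" if "l \<ge> 1" for l
    proof (rule sum_le_imp_pointwise_eq[where A = "{1..max k l}" and f = "\<lambda>l. ?c div ?\<phi> l" and g = "\<lambda>l. ?N l k (a k)" and x = l])
      have "enat (\<Sum>l=1..max k l. ?N l k (a k)) \<le> ord_sum b a k (a k)" by (rule ord_sum_bounds(1)[OF b])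
      also have "\<dots> \<le> enat (level_sum b ?c k)" by (rule ord_sum_le_level_sum[OF b a])
      finally have "(\<Sum>l=1..max k l. ?N l k (a k)) \<le> level_sum b ?c k" by simp
      also have "\<dots> \<le> (\<Sum>l=1..max k l. ?c div ?\<phi> l)"
        unfolding level_sum_def by (intro sum_mono2) auto
      finally show "(\<Sum>l=1..max k l. ?N l k (a k)) \<le> (\<Sum>l=1..max k l. ?c div ?\<phi> l)" .
    qed (use that lower True in auto)
    have N: "?N m (Suc k) y = (if int b ^ m dvd y - a k then Suc (?c div ?\<phi> m) else ?N m k y)" for y
      using greedy[OF Suc.prems(1)] residue_count_cong[of b m y "a k" a k] by (auto simp: residue_count_def)
    have \<phi>: "?\<phi> m > 0" using b by simp
    have u: "?\<phi> m * (?c div ?\<phi> m) \<le> ?c" "?c < ?\<phi> m * (?c div ?\<phi> m) + ?\<phi> m"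
      using dividend_less_times_div[OF \<phi>, of ?c] by simp_all
    have upper: "?\<phi> m * ?N m (Suc k) y < Suc ?c + ?\<phi> m" if "coprime y (int b)" for y
      using u(1) Suc.IH[OF Suc.prems(1) that] unfolding N by (auto simp: less_Suc_eq_le)
    \<comment> \<open>If this failed, the new average over all unit classes would be exactly one
      more than the count at \<open>x\<close>. No class exceeds that average, so all would equal it,
      but the class of \<open>x\<close> received nothing.\<close>
    have "Suc ?c < ?\<phi> m * ?N m (Suc k) x + ?\<phi> m"
    proof (rule ccontr)
      assume not: "\<not> ?thesis"
      have ndvd: "\<not> int b ^ m dvd x - a k"
      proof
        assume "int b ^ m dvd x - a k"
        then have "?N m (Suc k) x = Suc (?c div ?\<phi> m)" unfolding N by simp
        then show False using not u(2) \<phi> by (simp only: mult_Suc_right)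
      qed
      then have eq: "Suc ?c = ?\<phi> m * Suc (?N m k x)"
        using not Suc.IH[OF Suc.prems] unfolding N by simp
      have le: "?N m (Suc k) y \<le> Suc (?N m k x)" if "coprime y (int b)" for y
      proof -
        have "?\<phi> m * ?N m (Suc k) y < ?\<phi> m * Suc (Suc (?N m k x))"
          using upper[OF that] unfolding eq by simp
        then have "?N m (Suc k) y < Suc (Suc (?N m k x))" using nat_mult_less_cancel1[OF \<phi>] by blast
        then show ?thesis by simp
      qed
      have "(\<Sum>r\<in>totatives (b ^ m). ?N m (Suc k) (int r)) = (\<Sum>r\<in>totatives (b ^ m). Suc (?N m k x))"
        unfolding sum_residue_count_totatives[OF b Suc.prems(1)] c eq by (simp add: totient_def)
      moreover define r where "r = nat (x mod int (b ^ m))"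
      have bm: "b ^ m > 1" using b Suc.prems by (intro one_less_power) auto
      have "0 \<le> x mod int (b ^ m)" using b by (intro pos_mod_sign) simp
      then have r: "int r = x mod int (b ^ m)" unfolding r_def by simp
      have rx: "int b ^ m dvd int r - x" unfolding r by (simp add: mod_eq_dvd_iff[symmetric])
      then have "coprime (int r) (int b)" using coprime_cong_power Suc.prems by blast
      then have cop: "coprime r (b ^ m)" by simp
      have "int r < int (b ^ m)" unfolding r using b by (intro pos_mod_bound) simp
      moreover have "r \<noteq> 0" using cop b Suc.prems(1) by (intro notI) auto
      ultimately have "?N m (Suc k) (int r) = Suc (?N m k x)"
        using le Suc.prems(1) cop
        by (intro sum_le_imp_pointwise_eq[where A = "totatives (b ^ m)" and f = "\<lambda>r. ?N m (Suc k) (int r)" and g = "\<lambda>_. Suc (?N m k x)" and x = r, symmetric])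
          (auto simp: totatives_def)
      moreover have "?N m (Suc k) (int r) = ?N m (Suc k) x" by (rule residue_count_cong[OF rx])
      moreover have "?N m (Suc k) x = ?N m k x" using ndvd unfolding N by simp
      ultimately show False by simp
    qed
    then show ?thesis using upper[OF Suc.prems(2)] unfolding c by simp
  qed
qed

text \<open>The balance inequalities give every unit class at least the floor at each level, so the
  upper bound from the cheap prime is attained.\<close>

lemma ord_sum_unit_eq:
  assumes b: "b \<ge> 2" and a: "is_b_ordering b {p. prime p} a" and "coprime (a k) (int b)"
  shows "ord_sum b a k (a k) = enat (level_sum b (unit_count b a k) k)"
proof (rule antisym[OF ord_sum_le_level_sum[OF b a]])
  have "unit_count b a k div totient (b ^ m) \<le> residue_count b a m k (a k)" if "m \<ge> 1" for m
  proof -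
    have "unit_count b a k < Suc (residue_count b a m k (a k)) * totient (b ^ m)"
      using residue_count_balanced[OF b a that assms(3), of k] by (simp add: mult.commute)
    from less_mult_imp_div_less[OF this] show ?thesis by simp
  qed
  then have "enat (level_sum b (unit_count b a k) k) \<le> enat (\<Sum>m=1..k. residue_count b a m k (a k))"
    unfolding level_sum_def by (auto intro!: sum_mono)
  also have "\<dots> \<le> ord_sum b a k (a k)" by (rule ord_sum_bounds(1)[OF b])
  finally show "enat (level_sum b (unit_count b a k) k) \<le> ord_sum b a k (a k)" .
qed

section \<open>Primes dividing the base\<close>

text \<open>If b divides p - a(j), then p divides the prime a(j), so a(j) = p. The cost is therefore
  nothing before p occurs and infinite afterwards.\<close>

lemma ord_sum_prime_divisor:
  assumes b: "b \<ge> 2" and a: "\<And>j. prime (a j)" and p: "prime p" "p dvd int b"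
  shows "ord_sum b a k p = (if p \<in> a ` {..<k} then \<infinity> else 0)"
proof (cases "p \<in> a ` {..<k}")
  case True
  then obtain j where "j < k" "p = a j" by auto
  then have "ord_sum b a k p = ord_b b (p - a j) + (\<Sum>i\<in>{..<k} - {j}. ord_b b (p - a i))"
    unfolding ord_sum_def by (intro sum.remove) auto
  then show ?thesis using True \<open>p = a j\<close> by (simp add: ord_b_def)
next
  case False
  have "ord_b b (p - a j) = 0" if "j < k" for j
  proof -
    have "p \<noteq> a j" using False that by auto
    then have "\<not> p dvd a j" using primes_dvd_imp_eq[OF p(1) a] by blast
    moreover have "p dvd a j" if "int b dvd p - a j"
      using dvd_diff[OF dvd_refl dvd_trans[OF p(2) that]] by simp
    ultimately have "\<not> int b dvd p - a j" by blast
    then show ?thesis using ord_b_bounds(2)[OF b, of 0 "p - a j"] by (simp add: zero_enat_def)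
  qed
  then show ?thesis using False by (simp add: ord_sum_def)
qed

lemma not_coprime_prime_iff: "prime p \<Longrightarrow> \<not> coprime p (int b) \<longleftrightarrow> p dvd int b"
  using prime_imp_coprime coprime_absorb_left not_prime_unit by blast

lemma omega_eq_card_int:
  assumes "b > 0"
  shows "omega b = card {p::int. prime p \<and> p dvd int b}" "finite {p::int. prime p \<and> p dvd int b}"
proof -
  have "{p::int. prime p \<and> p dvd int b} = int ` prime_factors b"
  proof (intro equalityI subsetI)
    fix p :: int assume p: "p \<in> {p. prime p \<and> p dvd int b}"
    then obtain n where "p = int n" using prime_ge_0_int by (metis mem_Collect_eq zero_le_imp_eq_int)
    then show "p \<in> int ` prime_factors b" using p assms by (auto simp: prime_factors_dvd)
  qed (auto simp: prime_factors_dvd)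
  then show "omega b = card {p::int. prime p \<and> p dvd int b}" "finite {p::int. prime p \<and> p dvd int b}"
    by (simp_all add: omega_def card_image)
qed

text \<open>Values in \<open>enat\<close> are well-ordered, so a minimiser exists at each step; the
  cost at step n depends only on the entries before n, as recursive choice requires.\<close>

lemma exists_b_ordering:
  assumes "x \<in> S"
  shows "\<exists>a. is_b_ordering b S a"
proof -
  let ?P = "\<lambda>f n r. r \<in> S \<and> (\<forall>y\<in>S. ord_sum b f n r \<le> ord_sum b f n y)"
  have "\<exists>f. \<forall>n::nat. ?P f n (f n)"
  proof (rule dependent_wellorder_choice)
    fix r and f g :: "nat \<Rightarrow> int" and n :: nat
    assume "\<And>y. y < n \<Longrightarrow> f y = g y"
    then have "ord_sum b f n = ord_sum b g n" by (auto simp: ord_sum_def fun_eq_iff)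
    then show "?P f n r = ?P g n r" by simp
  next
    fix n and f :: "nat \<Rightarrow> int"
    let ?v = "LEAST v. v \<in> ord_sum b f n ` S"
    have "?v \<in> ord_sum b f n ` S" 
      using LeastI[of "\<lambda>v. v \<in> ord_sum b f n ` S" "ord_sum b f n x"] assms by blast
    then obtain r where "r \<in> S" "?v = ord_sum b f n r" by auto
    then have "?P f n r" using Least_le[of "\<lambda>v. v \<in> ord_sum b f n ` S"] by auto
    then show "\<exists>r. ?P f n r" by blast
  qed
  then show ?thesis unfolding is_b_ordering_def by blast
qed


text \<open>While p is still available at cost 0, every step up to k costs 0. A unit chosen at cost
  0 requires fewer than phi(b) units before it, so at most phi(b) units can have been
  chosen.\<close>

lemma exponent_prime_divisor_unused:
  assumes b: "b \<ge> 2" and a: "is_b_ordering b {p. prime p} a"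
    and p: "prime p" "p dvd int b" "p \<notin> a ` {..<k}"
  shows "ord_sum b a k (a k) = 0" "unit_count b a k \<le> totient b"
proof -
  have prime: "prime (a j)" for j using a by (auto simp: is_b_ordering_def)
  have zero: "ord_sum b a i (a i) = 0" if "i \<le> k" for i
  proof (cases "i \<ge> 1")
    case True
    then have "ord_sum b a i (a i) \<le> ord_sum b a i p" using a p(1) by (auto simp: is_b_ordering_def)
    also have "\<dots> = 0" using ord_sum_prime_divisor[where k = i, OF b prime p(1,2)] p(3) that by auto
    finally show ?thesis by simp
  next
    case False
    then have "i = 0" by simp
    then show ?thesis by (simp add: ord_sum_def)
  qed
  show "ord_sum b a k (a k) = 0" using zero by simp
  have "unit_count b a i \<le> totient b" if "i \<le> k" for i
    using that
  proof (induction i)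
    case (Suc i)
    show ?case
    proof (cases "coprime (a i) (int b)")
      case True
      have "level_sum b (unit_count b a i) i = 0"
        using ord_sum_unit_eq[where a = a, OF b a True] zero[of i] Suc.prems by (simp add: zero_enat_def)
      then have "\<forall>m\<in>{1..i}. unit_count b a i div totient (b ^ m) = 0"
        by (simp add: level_sum_def)
      \<comment> \<open>Only level 1 matters. For i = 0 the level sum is empty, and the bound comes
        from there being no earlier units.\<close>
      from bspec[OF this, of 1] have "i \<ge> 1 \<Longrightarrow> unit_count b a i div totient (b ^ 1) = 0" by simp
      moreover have "totient b > 0" using b by simp
      ultimately have "unit_count b a i < totient b"
      proof (cases "i \<ge> 1")
        case False
        then show ?thesis using unit_count_le[of b a i] \<open>totient b > 0\<close> by linarith
      qed (simp add: div_eq_0_iff)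
      then show ?thesis using True by (simp add: unit_count_def)
    next
      case False
      then show ?thesis using Suc by (simp add: unit_count_def)
    qed
  qed (simp add: unit_count_def)
  then show "unit_count b a k \<le> totient b" by simp
qed

text \<open>The minimum is always finite, whereas repeating a prime divisor of \<open>b\<close>
  costs infinity. So each occurs at most once, and the entries before k split into units and
  distinct prime divisors.\<close>

lemma prime_divisors_used:
  assumes b: "b \<ge> 2" and a: "is_b_ordering b {p. prime p} a"
  shows "k = unit_count b a k + card (a ` {..<k} \<inter> {p. prime p \<and> p dvd int b})"
    and "{p. prime p \<and> p dvd int b} \<subseteq> a ` {..<k} \<Longrightarrow> coprime (a k) (int b)"
proof -
  have prime: "prime (a j)" for j using a by (auto simp: is_b_ordering_def)
  have fresh: "a j \<notin> a ` {..<j}" if "\<not> coprime (a j) (int b)" for j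
  proof
    assume "a j \<in> a ` {..<j}"
    then have "ord_sum b a j (a j) = \<infinity>"
      using ord_sum_prime_divisor[where k = j and p = "a j", OF b prime prime] not_coprime_prime_iff[OF prime] that by simp
    then show False using ord_sum_le_level_sum[OF b a, of j] by simp
  qed
  show "coprime (a k) (int b)" if "{p. prime p \<and> p dvd int b} \<subseteq> a ` {..<k}"
    using that fresh[of k] prime[of k] not_coprime_prime_iff[of "a k" b] by blast
  let ?D = "{j \<in> {..<k}. \<not> coprime (a j) (int b)}"
  have inj: "inj_on a ?D"
  proof (rule linorder_inj_onI)
    fix i j assume "i < j" "i \<in> ?D" "j \<in> ?D"
    then have "a i \<in> a ` {..<j}" "a j \<notin> a ` {..<j}" using fresh[of j] by simp_all
    then show "a i \<noteq> a j" by metis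
  qed auto
  have "a ` ?D = a ` {..<k} \<inter> {p. prime p \<and> p dvd int b}"
    using prime not_coprime_prime_iff by auto
  with card_image[OF inj] have "card (a ` {..<k} \<inter> {p. prime p \<and> p dvd int b}) = card ?D" by simp
  moreover have "unit_count b a k = card {j \<in> {..<k}. coprime (a j) (int b)}"
    by (simp add: unit_count_def of_bool_def sum.If_cases Int_def)
  moreover have "card {j \<in> {..<k}. coprime (a j) (int b)} + card ?D = card {..<k}"
  proof -
    have "{..<k} = {j \<in> {..<k}. coprime (a j) (int b)} \<union> ?D" by auto
    then have "card {..<k} = card ({j \<in> {..<k}. coprime (a j) (int b)} \<union> ?D)" by (rule arg_cong)
    also have "\<dots> = card {j \<in> {..<k}. coprime (a j) (int b)} + card ?D" by (rule card_Un_disjoint) auto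
    finally show ?thesis ..
  qed
  ultimately show "k = unit_count b a k + card (a ` {..<k} \<inter> {p. prime p \<and> p dvd int b})" by simp
qed

section \<open>Evaluation of the closed formula\<close>

lemma sum_div_nonpos:
  assumes "b \<ge> 2" "x < int (totient b)"
  shows "(\<Sum>j\<le>k. x div int (b ^ j * totient b)) \<le> 0"
proof (rule sum_nonpos)
  fix j
  have "1 * totient b \<le> b ^ j * totient b" using assms(1) by (intro mult_right_mono) auto
  then have "x < int (b ^ j * totient b)" using assms(2) by linarith
  moreover have "0 < int (b ^ j * totient b)" using assms(1) by simp
  ultimately show "x div int (b ^ j * totient b) \<le> 0"
    using zdiv_mono1[of x "int (b ^ j * totient b) - 1" "int (b ^ j * totient b)"] by (simp add: div_pos_pos_trivial)
qed

text \<open>Level m = j + 1 has phi(b^(j+1)) = b^j phi(b); the extra term j = k belongs to level k +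
  1 and vanishes.\<close>

lemma level_sum_eq:
  assumes "b \<ge> 2" "c \<le> k"
  shows "int (level_sum b c k) = (\<Sum>j\<le>k. int c div int (b ^ j * totient b))"
proof -
  have "(\<Sum>j\<le>k. c div (b ^ j * totient b)) = (\<Sum>j\<le>k. c div totient (b ^ Suc j))"
    unfolding totient_power_Suc ..
  also have "\<dots> = (\<Sum>j<k. c div totient (b ^ Suc j)) + c div totient (b ^ Suc k)"
    unfolding lessThan_Suc_atMost[symmetric] by (rule sum.lessThan_Suc)
  also have "c div totient (b ^ Suc k) = 0" by (rule div_totient_power_eq_0[OF assms]) simp
  also have "(\<Sum>j<k. c div totient (b ^ Suc j)) = level_sum b c k"
    unfolding level_sum_def by (simp add: sum.atLeast1_atMost_eq)
  finally have "level_sum b c k = (\<Sum>j\<le>k. c div (b ^ j * totient b))" by simp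
  then show ?thesis by (simp only: of_nat_sum zdiv_int)
qed

text \<open>The infinite sum of floors is represented by its terms j <= k. For k >= omega(b) all
  later terms are 0; for smaller k every floor is negative, and both the finite and the infinite sum
  are replaced by 0 through \<open>max\<close>.\<close>

theorem theorem8p1:
  fixes b k :: nat
  assumes "b \<ge> 2"
  shows "(\<exists>a. is_b_ordering b {p :: int. prime p} a) \<and>
         (\<forall>a. is_b_ordering b {p :: int. prime p} a \<longrightarrow>
            alpha_of b a k =
              enat (nat (max 0 (\<Sum>j\<le>k. (int k - int (omega b)) div int (b ^ j * totient b))))
            \<and> (totient b + omega b > k \<longrightarrow> alpha_of b a k = 0))"
proof (intro conjI allI impI)
  show "\<exists>a. is_b_ordering b {p :: int. prime p} a"
    by (rule exists_b_ordering[of 2]) simp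
next
  fix a assume a: "is_b_ordering b {p :: int. prime p} a"
  let ?T = "\<Sum>j\<le>k. (int k - int (omega b)) div int (b ^ j * totient b)"
  let ?D = "{p :: int. prime p \<and> p dvd int b}"
  have D: "omega b = card ?D" "finite ?D" using omega_eq_card_int[of b] assms by simp_all
  note k = prime_divisors_used(1)[OF assms a, of k]
  show formula: "alpha_of b a k = enat (nat (max 0 ?T))"
  proof (cases "?D \<subseteq> a ` {..<k}")
    case True
    then have "a ` {..<k} \<inter> ?D = ?D" by blast
    then have c: "int (unit_count b a k) = int k - int (omega b)" using k D(1) by simp
    have "alpha_of b a k = enat (level_sum b (unit_count b a k) k)"
      unfolding alpha_of_def by (rule ord_sum_unit_eq[OF assms a prime_divisors_used(2)[OF assms a True]])
    moreover have "?T = int (level_sum b (unit_count b a k) k)"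
      using level_sum_eq[OF assms unit_count_le[of b a k]] by (simp add: c)
    ultimately show ?thesis by simp
  next
    case False
    then obtain p where p: "prime p" "p dvd int b" "p \<notin> a ` {..<k}" by blast
    have "card (a ` {..<k} \<inter> ?D) < card ?D"
      using p D(2) by (intro psubset_card_mono) auto
    \<comment> \<open>At most omega(b) - 1 prime divisors and at most phi(b) units precede k, which
      gives k - omega(b) <= phi(b) - 1.\<close>
    then have "int k - int (omega b) < int (totient b)"
      using k D(1) exponent_prime_divisor_unused(2)[OF assms a p] by linarith
    then have "?T \<le> 0" by (rule sum_div_nonpos[OF assms])
    then show ?thesis
      using exponent_prime_divisor_unused(1)[OF assms a p] by (simp add: alpha_of_def zero_enat_def)
  qed
  assume "totient b + omega b > k"
  then have "?T \<le> 0" by (intro sum_div_nonpos assms) linarith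
  then show "alpha_of b a k = 0" unfolding formula by (simp add: zero_enat_def)
qed

end
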